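(* Let $n\ge 2$ and let $w\in W_c(B_n)$. Then $w$ is irreducible if and only if $w$ is equal to one of the following elements: (i) $w_p$; (ii) $s_1s_2w_p$, where $s_1,s_2,s_3\notin \mathrm{supp}(w_p)$; (iii) $s_2s_1w_p$, where $s_1,s_2,s_3\notin \mathrm{supp}(w_p)$; where in each case $w_p$ is a product of (pairwise distinct) commuting generators in $W_c(B_n)$, the empty product being allowed. Analogously, let $w\in W_c(B'_n)$. Then $w$ is irreducible if and only if $w$ is equal to one of $w_p$; $s_{n+1}s_nw_p$ with $s_{n+1},s_n,s_{n-1}\notin\mathrm{supp}(w_p)$; $s_ns_{n+1}w_p$ with $s_{n+1},s_n,s_{n-1}\notin\mathrm{supp}(w_p)$; where in each case $w_p$ is a (possibly empty) product of (pairwise distinct) commuting generators in $W_c(B'_n)$.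
   Context: $W(\widetilde C_n)$ ($n\ge 2$) is the Coxeter group with generators $s_1,\dots,s_{n+1}$ and Coxeter exponents $m(s_i,s_i)=1$, $m(s_i,s_j)=2$ if $|i-j|>1$, $m(s_i,s_j)=3$ if $|i-j|=1$ and $1<i,j<n+1$, and $m(s_1,s_2)=m(s_n,s_{n+1})=4$. $W(B_n)$ is the parabolic subgroup generated by $s_1,\dots,s_n$ and $W(B'_n)$ the one generated by $s_2,\dots,s_{n+1}$. For a Coxeter group $W(X)$ with length $l$: $\mathcal L(w)=\{s: l(sw)<l(w)\}$ and $\mathcal R(w)=\{s: l(ws)<l(w)\}$; $\mathrm{supp}(w)$ is the set of generators occurring in any reduced expression of $w$; $w$ is fully commutative if any two of its reduced expressions are related by commutations $st\mapsto ts$ with $m(s,t)=2$; $W_c(X)$ is the set of fully commutative elements. For $w\in W_c(X)$ and generators $s,t$ with $m(s,t)\ge3$: $w$ is left weak star reducible by $s$ with respect to $t$ (to $sw$) if $s\in\mathcal L(w)$, $t\in\mathcal L(sw)$ and $tw\notin W_c(X)$; $w$ is right weak star reducible by $s$ with respect to $t$ (to $ws$) if $s\in\mathcal R(w)$, $t\in\mathcal R(ws)$ and $wt\notin W_c(X)$. $w$ is irreducible if it is neither left nor right weak star reducible by any $s$ with respect to any $t$. Conditions such as $s_3\notin\mathrm{supp}(w_p)$ are vacuous when the generator is not in the group under consideration. *)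

theory Defs
  imports "HOL-Algebra.Generated_Groups"
begin

text \<open>Only finite Coxeter exponents are covered; there is no encoding of \<open>m s t = \<infinity>\<close>.\<close>

locale coxeter =
  fixes S :: "'a set" and m :: "'a \<Rightarrow> 'a \<Rightarrow> nat"
  assumes m_diag: "s \<in> S \<Longrightarrow> m s s = 1"
    and m_sym: "s \<in> S \<Longrightarrow> t \<in> S \<Longrightarrow> m s t = m t s"
    and m_off_diag: "s \<in> S \<Longrightarrow> t \<in> S \<Longrightarrow> s \<noteq> t \<Longrightarrow> 2 \<le> m s t"
begin

text \<open>
  The least congruence on words over \<open>S\<close> containing the relations \<open>(s t)^(m s t) = 1\<close>.
  Since \<open>m s s = 1\<close> makes every generator an involution, no formal inverses of the
  generators are needed, and the monoid presented in this way is the Coxeter group.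
\<close>

inductive cox_eq :: "'a list \<Rightarrow> 'a list \<Rightarrow> bool" where
  relator: "s \<in> S \<Longrightarrow> t \<in> S \<Longrightarrow> cox_eq (concat (replicate (m s t) [s, t])) []"
| refl: "u \<in> lists S \<Longrightarrow> cox_eq u u"
| sym: "cox_eq u v \<Longrightarrow> cox_eq v u"
| trans: "cox_eq u v \<Longrightarrow> cox_eq v w \<Longrightarrow> cox_eq u w"
| append: "cox_eq u v \<Longrightarrow> cox_eq u' v' \<Longrightarrow> cox_eq (u @ u') (v @ v')"

definition cls :: "'a list \<Rightarrow> 'a list set" where
  "cls u = {v. cox_eq u v}"

definition W :: "'a list set monoid" where
  "W = \<lparr>carrier = cls ` lists S,
        monoid.mult = (\<lambda>A B. {w. \<exists>a\<in>A. \<exists>b\<in>B. cox_eq (a @ b) w}),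
        one = cls []\<rparr>"

definition gen :: "'a \<Rightarrow> 'a list set" where
  "gen s = cls [s]"

definition word_prod :: "'a list \<Rightarrow> 'a list set" where
  "word_prod u = foldr (\<otimes>\<^bsub>W\<^esub>) (map gen u) \<one>\<^bsub>W\<^esub>"

lemma cox_eq_words: "cox_eq u v \<Longrightarrow> u \<in> lists S \<and> v \<in> lists S"
  by (induction rule: cox_eq.induct) (auto split: if_splits)

lemma cls_eq_iff:
  assumes "u \<in> lists S"
  shows "cls u = cls v \<longleftrightarrow> cox_eq u v"
  using assms cox_eq.refl cox_eq.sym cox_eq.trans unfolding cls_def by blast

lemma mult_cls:
  assumes "u \<in> lists S" "v \<in> lists S"
  shows "cls u \<otimes>\<^bsub>W\<^esub> cls v = cls (u @ v)"
proof -
  have "cox_eq u u" "cox_eq v v"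
    using assms by (auto intro: cox_eq.refl)
  then show ?thesis
    unfolding W_def cls_def
    by (auto intro: cox_eq.append cox_eq.trans cox_eq.sym)
qed

lemma rev_cancel: "u \<in> lists S \<Longrightarrow> cox_eq (rev u @ u) []"
proof (induction u)
  case Nil
  show ?case by (simp add: cox_eq.refl)
next
  case (Cons s u)
  then have s: "s \<in> S" and u: "u \<in> lists S" by auto
  have "cox_eq [s, s] []"
    using cox_eq.relator[OF s s] m_diag[OF s] by simp
  moreover have "cox_eq u u" "cox_eq (rev u) (rev u)"
    using u by (auto intro: cox_eq.refl)
  ultimately have "cox_eq (rev u @ ([s, s] @ u)) (rev u @ ([] @ u))"
    by (blast intro: cox_eq.append)
  then show ?case
    using Cons.IH[OF u] cox_eq.trans by fastforce
qed

lemma group_W: "group W"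
proof (rule groupI)
  show "\<one>\<^bsub>W\<^esub> \<in> carrier W"
    by (auto simp: W_def)
next
  fix x y assume "x \<in> carrier W" "y \<in> carrier W"
  then obtain u v where "u \<in> lists S" "x = cls u" "v \<in> lists S" "y = cls v"
    by (auto simp: W_def)
  then show "x \<otimes>\<^bsub>W\<^esub> y \<in> carrier W"
    using mult_cls[of u v] by (auto simp: W_def)
next
  fix x y z assume "x \<in> carrier W" "y \<in> carrier W" "z \<in> carrier W"
  then obtain u v w where "u \<in> lists S" "x = cls u" "v \<in> lists S" "y = cls v"
    "w \<in> lists S" "z = cls w"
    by (auto simp: W_def)
  then show "x \<otimes>\<^bsub>W\<^esub> y \<otimes>\<^bsub>W\<^esub> z = x \<otimes>\<^bsub>W\<^esub> (y \<otimes>\<^bsub>W\<^esub> z)"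
    by (simp add: mult_cls)
next
  fix x assume "x \<in> carrier W"
  then obtain u where u: "u \<in> lists S" "x = cls u"
    by (auto simp: W_def)
  have one: "\<one>\<^bsub>W\<^esub> = cls []"
    by (simp add: W_def)
  show "\<one>\<^bsub>W\<^esub> \<otimes>\<^bsub>W\<^esub> x = x"
    using mult_cls[of "[]" u] u by (simp add: one)
  have ru: "rev u \<in> lists S"
    using u(1) by auto
  have "cls (rev u) \<otimes>\<^bsub>W\<^esub> x = \<one>\<^bsub>W\<^esub>"
    using ru mult_cls[of "rev u" u] cls_eq_iff[of "rev u @ u" "[]"] rev_cancel[of u] u
    by (simp add: one)
  moreover have "cls (rev u) \<in> carrier W"
    using ru by (auto simp: W_def)
  ultimately show "\<exists>y\<in>carrier W. y \<otimes>\<^bsub>W\<^esub> x = \<one>\<^bsub>W\<^esub>" by blast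
qed

lemma word_prod_eq_cls: "u \<in> lists S \<Longrightarrow> word_prod u = cls u"
proof (induction u)
  case Nil
  show ?case by (simp add: word_prod_def W_def)
next
  case (Cons s u)
  then show ?case
    using mult_cls[of "[s]" u] by (simp add: word_prod_def gen_def)
qed

end

text \<open>
  The parabolic subgroup generated by \<open>I\<close>, regarded as a Coxeter group with generators \<open>I\<close>:
  expressions, length, descents and full commutativity all refer to words over \<open>I\<close>.
  Taking \<open>I = S\<close> gives the whole Coxeter group.
\<close>

locale parabolic = coxeter S m for S :: "'a set" and m +
  fixes I :: "'a set"
  assumes I_subset: "I \<subseteq> S"
begin

definition P :: "'a list set set" where
  "P = generate W (gen ` I)"

definition len :: "'a list set \<Rightarrow> nat" where
  "len w = (LEAST k. \<exists>u \<in> lists I. word_prod u = w \<and> length u = k)"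

definition reduced_expr :: "'a list \<Rightarrow> 'a list set \<Rightarrow> bool" where
  "reduced_expr u w \<longleftrightarrow> u \<in> lists I \<and> word_prod u = w \<and> length u = len w"

text \<open>
  All reduced expressions of an element involve the same generators (Matsumoto), so the union
  below agrees with the set of letters of any single one.
\<close>

definition supp :: "'a list set \<Rightarrow> 'a set" where
  "supp w = (\<Union>u \<in> {u. reduced_expr u w}. set u)"

definition left_descents :: "'a list set \<Rightarrow> 'a set" where
  "left_descents w = {s \<in> I. len (gen s \<otimes>\<^bsub>W\<^esub> w) < len w}"

definition right_descents :: "'a list set \<Rightarrow> 'a set" where
  "right_descents w = {s \<in> I. len (w \<otimes>\<^bsub>W\<^esub> gen s) < len w}"

inductive commutation :: "'a list \<Rightarrow> 'a list \<Rightarrow> bool" where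
  "s \<in> I \<Longrightarrow> t \<in> I \<Longrightarrow> m s t = 2 \<Longrightarrow> commutation (u @ [s, t] @ v) (u @ [t, s] @ v)"

definition fully_commutative :: "'a list set \<Rightarrow> bool" where
  "fully_commutative w \<longleftrightarrow>
    (\<forall>u v. reduced_expr u w \<longrightarrow> reduced_expr v w \<longrightarrow> commutation\<^sup>*\<^sup>* u v)"

definition Wc :: "'a list set set" where
  "Wc = {w \<in> P. fully_commutative w}"

definition left_weak_star_reducible :: "'a \<Rightarrow> 'a \<Rightarrow> 'a list set \<Rightarrow> bool" where
  "left_weak_star_reducible s t w \<longleftrightarrow>
    3 \<le> m s t \<and> s \<in> left_descents w \<and> t \<in> left_descents (gen s \<otimes>\<^bsub>W\<^esub> w) \<and>
    gen t \<otimes>\<^bsub>W\<^esub> w \<notin> Wc"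

definition right_weak_star_reducible :: "'a \<Rightarrow> 'a \<Rightarrow> 'a list set \<Rightarrow> bool" where
  "right_weak_star_reducible s t w \<longleftrightarrow>
    3 \<le> m s t \<and> s \<in> right_descents w \<and> t \<in> right_descents (w \<otimes>\<^bsub>W\<^esub> gen s) \<and>
    w \<otimes>\<^bsub>W\<^esub> gen t \<notin> Wc"

definition irreducible :: "'a list set \<Rightarrow> bool" where
  "irreducible w \<longleftrightarrow>
    \<not> (\<exists>s\<in>I. \<exists>t\<in>I. left_weak_star_reducible s t w \<or> right_weak_star_reducible s t w)"

definition commuting_products :: "'a list set set" where
  "commuting_products =
    {w \<in> Wc. \<exists>u \<in> lists I. distinct u \<and>
      (\<forall>s\<in>set u. \<forall>t\<in>set u. gen s \<otimes>\<^bsub>W\<^esub> gen t = gen t \<otimes>\<^bsub>W\<^esub> gen s) \<and> w = word_prod u}"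

end

abbreviation gens_C :: "nat \<Rightarrow> nat set" where
  "gens_C n \<equiv> {1..n+1}"

abbreviation gens_B :: "nat \<Rightarrow> nat set" where
  "gens_B n \<equiv> {1..n}"

abbreviation gens_B' :: "nat \<Rightarrow> nat set" where
  "gens_B' n \<equiv> {2..n+1}"

definition m_C :: "nat \<Rightarrow> nat \<Rightarrow> nat \<Rightarrow> nat" where
  "m_C n i j =
    (if i = j then 1
     else if \<bar>int i - int j\<bar> > 1 then 2
     else if {i, j} = {1, 2} \<or> {i, j} = {n, n + 1} then 4
     else 3)"

lemma coxeter_C: "coxeter (gens_C n) (m_C n)"
  by unfold_locales (auto simp: m_C_def insert_commute abs_minus_commute)

lemma parabolic_B: "parabolic (gens_C n) (m_C n) (gens_B n)"
  by (intro parabolic.intro coxeter_C parabolic_axioms.intro) auto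

lemma parabolic_B': "parabolic (gens_C n) (m_C n) (gens_B' n)"
  by (intro parabolic.intro coxeter_C parabolic_axioms.intro) auto

abbreviation s_C :: "nat \<Rightarrow> nat \<Rightarrow> nat list set" where
  "s_C n \<equiv> coxeter.gen (gens_C n) (m_C n)"

abbreviation W_C :: "nat \<Rightarrow> nat list set monoid" where
  "W_C n \<equiv> coxeter.W (gens_C n) (m_C n)"

abbreviation Wc_B :: "nat \<Rightarrow> nat list set set" where
  "Wc_B n \<equiv> parabolic.Wc (gens_C n) (m_C n) (gens_B n)"

abbreviation Wc_B' :: "nat \<Rightarrow> nat list set set" where
  "Wc_B' n \<equiv> parabolic.Wc (gens_C n) (m_C n) (gens_B' n)"

abbreviation irreducible_B :: "nat \<Rightarrow> nat list set \<Rightarrow> bool" where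
  "irreducible_B n \<equiv> parabolic.irreducible (gens_C n) (m_C n) (gens_B n)"

abbreviation irreducible_B' :: "nat \<Rightarrow> nat list set \<Rightarrow> bool" where
  "irreducible_B' n \<equiv> parabolic.irreducible (gens_C n) (m_C n) (gens_B' n)"

abbreviation supp_B :: "nat \<Rightarrow> nat list set \<Rightarrow> nat set" where
  "supp_B n \<equiv> parabolic.supp (gens_C n) (m_C n) (gens_B n)"

abbreviation supp_B' :: "nat \<Rightarrow> nat list set \<Rightarrow> nat set" where
  "supp_B' n \<equiv> parabolic.supp (gens_C n) (m_C n) (gens_B' n)"

abbreviation commuting_products_B :: "nat \<Rightarrow> nat list set set" where
  "commuting_products_B n \<equiv> parabolic.commuting_products (gens_C n) (m_C n) (gens_B n)"

abbreviation commuting_products_B' :: "nat \<Rightarrow> nat list set set" where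
  "commuting_products_B' n \<equiv> parabolic.commuting_products (gens_C n) (m_C n) (gens_B' n)"

end

theory Submission
  imports Defs
begin

text \<open>
  The elements in question are governed by their reduced words, and the proof has four
  ingredients.

  \<^item> Exchange. A word \<open>s\<^sub>1 \<dots> s\<^sub>k\<close> lists the reflections \<open>s\<^sub>1\<close>, \<open>s\<^sub>1 s\<^sub>2 s\<^sub>1\<close>, and so on. The parity
    of the number of times that a reflection is listed depends only on the group element
    (\<open>refl_count_parity\<close>), because a relator \<open>(s t)^m\<close> lists the same \<open>m\<close> reflections twice.
    A repetition in the list lets two letters be deleted, so reduced words list each reflection
    at most once, and the exchange condition (\<open>exchange\<close>) follows. Deleting letters keeps a
    word inside the generating set \<open>I\<close> of a parabolic subgroup, so the argument applies
    directly to lengths measured over \<open>I\<close>.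

  \<^item> Orders. The presentation only bounds the order of \<open>s t\<close> from above. For exponents at most
    4, an integral Cartan matrix gives an action on integer functions which shows that \<open>s t\<close>
    has order exactly \<open>m s t\<close> (\<open>alt_neq\<close>) and that a generator is not a product of other
    generators (\<open>generator_not_in_word\<close>).

  \<^item> Translation into words. A reduced word containing an alternating factor of length
    \<open>m s t \<ge> 3\<close> does not represent a fully commutative element, since commutations preserve the
    subword of letters \<open>s\<close> and \<open>t\<close> (\<open>braid_not_in_Wc\<close>). Hence a fully commutative element with a
    reduced word that starts with \<open>m s t - 1\<close> alternating letters \<open>s t s \<dots>\<close> is left reducible
    (\<open>left_reducible_if_prefix\<close>). In the other direction, an alternating word with fewer than
    \<open>m s t\<close> letters followed by generators that commute with it and with each other is the
    only reduced word of its element up to commutations (\<open>normal_form_unique\<close>). This makes the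
    listed elements irreducible: replacing \<open>s\<^sub>1 s\<^sub>2 w\<^sub>p\<close> by \<open>s\<^sub>2 s\<^sub>1 s\<^sub>2 w\<^sub>p\<close> still gives a fully
    commutative element, as \<open>3 < 4\<close>.

  \<^item> Combinatorics on the path \<open>1 - 2 - \<dots> - n\<close>. It remains to see that a class of words in
    which the forbidden factors, prefixes and suffixes never appear contains a word of one of
    the three listed shapes (\<open>irreducible_fc_form\<close>). If \<open>k\<close> is the largest letter such that \<open>k\<close> and
    \<open>k + 1\<close> both occur, then between two occurrences of a letter there must be enough
    neighbouring letters. Since \<open>k + 1\<close> has no neighbour above it, this forces occurrences of
    \<open>k - 1\<close>, then of \<open>k - 2\<close>, and so on down to the end of the path, where a factor \<open>1 2 1 2\<close> or
    a prefix \<open>1 2 1\<close> results unless \<open>k = 1\<close>.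

  Both halves of the theorem are instances of one result about a labelling of the generators by
  \<open>1, \<dots>, n\<close> along the Coxeter graph with the double edge between 1 and 2
  (\<open>irreducible_iff\<close>): the labelling is \<open>i \<mapsto> i\<close> for \<open>B\<close> and \<open>i \<mapsto> n + 2 - i\<close> for \<open>B'\<close>.
\<close>

section \<open>Alternating words\<close>

fun alt :: "'a \<Rightarrow> 'a \<Rightarrow> nat \<Rightarrow> 'a list" where
  "alt s t 0 = []"
| "alt s t (Suc k) = s # alt t s k"

lemma length_alt [simp]: "length (alt s t k) = k"
  by (induction k arbitrary: s t) auto

lemma set_alt: "set (alt s t k) \<subseteq> {s, t}"
  by (induction k arbitrary: s t) fastforce+

lemma concat_replicate_alt: "concat (replicate k [s, t]) = alt s t (2 * k)"
  by (induction k) auto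

lemma alt_even_add: "alt s t (2 * k + j) = alt s t (2 * k) @ alt s t j"
  by (induction k) auto

lemma alt_odd_Suc: "s # alt t s (2 * i + 1) @ [s] = alt s t (2 * i + 3)"
proof -
  have "alt t s (2 * i + 1) @ [s] = alt t s (2 * i + 2)"
    using alt_even_add[of t s i 1] alt_even_add[of t s i 2] by (simp add: numeral_2_eq_2)
  moreover have "alt s t (2 * i + 3) = s # alt t s (2 * i + 2)"
    using alt.simps(2)[of s t "2 * i + 2"] by (simp add: numeral_3_eq_3 del: alt.simps)
  ultimately show ?thesis by simp
qed

lemma rev_alt_even: "rev (alt s t (2 * k)) = alt t s (2 * k)"
proof (induction k)
  case (Suc k)
  have "rev (alt s t (2 * Suc k)) = rev (alt s t (2 * k)) @ [t, s]"
    by simp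
  also have "\<dots> = alt t s (2 * k + 2)"
    unfolding Suc alt_even_add by (simp add: numeral_2_eq_2)
  finally show ?case by (simp add: algebra_simps)
qed simp

lemma take_alt: "take i (alt s t k) = alt s t (min i k)"
proof (induction k arbitrary: i s t)
  case (Suc k)
  then show ?case by (cases i) auto
qed simp

lemma alt_prefix_split:
  assumes "alt s t k = a @ y # b"
  shows "a @ [y] = alt s t (Suc (length a))"
  using assms
proof (induction a arbitrary: s t k)
  case Nil
  then show ?case by (cases k) auto
next
  case (Cons x a)
  then obtain k' where k: "k = Suc k'" "x = s" "alt t s k' = a @ y # b"
    by (cases k) auto
  show ?case using Cons.IH[OF k(3)] k(2) by simp
qed

section \<open>Reflections listed by a word\<close>

context coxeter
begin

notation cox_eq (infix "\<approx>" 50)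

lemma cox_eq_context:
  assumes "u \<approx> v" "a \<in> lists S" "b \<in> lists S"
  shows "a @ u @ b \<approx> a @ v @ b"
  using assms by (meson cox_eq.append cox_eq.refl)

lemma cancel_rev: "u \<in> lists S \<Longrightarrow> u @ rev u \<approx> []"
  using rev_cancel[of "rev u"] by (simp add: in_lists_conv_set)

lemma cancel_left_iff:
  assumes "a \<in> lists S" "u \<in> lists S" "v \<in> lists S"
  shows "a @ u \<approx> a @ v \<longleftrightarrow> u \<approx> v"
proof
  assume *: "a @ u \<approx> a @ v"
  have ra: "rev a \<in> lists S" using assms(1) by auto
  have **: "rev a @ a @ u \<approx> rev a @ a @ v"
    using cox_eq_context[OF * ra, of "[]"] by simp
  have del: "rev a @ a @ x \<approx> x" if "x \<in> lists S" for x
    using cox_eq_context[OF rev_cancel[OF assms(1)], of "[]" x] that by simp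
  show "u \<approx> v"
    using del[OF assms(2)] del[OF assms(3)] ** by (meson cox_eq.sym cox_eq.trans)
next
  assume "u \<approx> v"
  then show "a @ u \<approx> a @ v"
    using cox_eq_context[of u v a "[]"] assms by simp
qed

lemma cancel_left_Cons_iff:
  assumes "s \<in> S" "u \<in> lists S" "v \<in> lists S"
  shows "s # u \<approx> s # v \<longleftrightarrow> u \<approx> v"
  using cancel_left_iff[of "[s]" u v] assms by simp

lemma cox_eq_rev: "u \<approx> v \<Longrightarrow> rev u \<approx> rev v"
proof (induction rule: cox_eq.induct)
  case (relator s t)
  then show ?case
    using cox_eq.relator[OF relator(2,1)] m_sym[of s t]
    by (simp add: concat_replicate_alt rev_alt_even)
next
  case (refl u)
  then show ?case by (auto intro: cox_eq.refl)
next
  case (append u v u' v')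
  then show ?case by (simp add: cox_eq.append)
qed (blast intro: cox_eq.sym cox_eq.trans)+

lemma cancel_right_iff:
  assumes "a \<in> lists S" "u \<in> lists S" "v \<in> lists S"
  shows "u @ a \<approx> v @ a \<longleftrightarrow> u \<approx> v"
proof -
  have "u @ a \<approx> v @ a \<longleftrightarrow> rev a @ rev u \<approx> rev a @ rev v"
    using cox_eq_rev[of "u @ a" "v @ a"] cox_eq_rev[of "rev a @ rev u" "rev a @ rev v"] by auto
  also have "\<dots> \<longleftrightarrow> rev u \<approx> rev v"
    using assms by (intro cancel_left_iff) auto
  also have "\<dots> \<longleftrightarrow> u \<approx> v"
    using cox_eq_rev[of u v] cox_eq_rev[of "rev u" "rev v"] by auto
  finally show ?thesis .
qed

lemma square_cancel: "s \<in> S \<Longrightarrow> [s, s] \<approx> []"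
  using rev_cancel[of "[s]"] by simp

lemma square_cancel_Cons: "s \<in> S \<Longrightarrow> u \<in> lists S \<Longrightarrow> s # s # u \<approx> u"
  using cox_eq_context[OF square_cancel, of s "[]" u] by simp

lemma Cons_swap_iff:
  assumes "s \<in> S" "u \<in> lists S" "v \<in> lists S"
  shows "s # u \<approx> v \<longleftrightarrow> u \<approx> s # v"
proof -
  have "s # u \<approx> v \<longleftrightarrow> s # u \<approx> s # s # v"
    using square_cancel_Cons[OF assms(1,3)] by (meson cox_eq.sym cox_eq.trans)
  also have "\<dots> \<longleftrightarrow> u \<approx> s # v"
    using assms by (intro cancel_left_Cons_iff) auto
  finally show ?thesis .
qed

lemma snoc_swap_iff:
  assumes "s \<in> S" "u \<in> lists S" "v \<in> lists S"
  shows "u @ [s] \<approx> v \<longleftrightarrow> u \<approx> v @ [s]"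
proof -
  have *: "x \<approx> y \<longleftrightarrow> rev x \<approx> rev y" for x y
    using cox_eq_rev[of x y] cox_eq_rev[of "rev x" "rev y"] by auto
  have r: "rev u \<in> lists S" "rev v \<in> lists S" using assms by auto
  show ?thesis
    using Cons_swap_iff[OF assms(1) r] *[of "u @ [s]" v] *[of u "v @ [s]"] by simp
qed

lemma conj_swap_iff:
  assumes "s \<in> S" "u \<in> lists S" "v \<in> lists S"
  shows "s # u @ [s] \<approx> v \<longleftrightarrow> u \<approx> s # v @ [s]"
  using Cons_swap_iff[of s "u @ [s]" v] snoc_swap_iff[of s u "s # v"] assms by simp

lemma cox_eq_even_length: "u \<approx> v \<Longrightarrow> even (length u) = even (length v)"
  by (induction rule: cox_eq.induct) (auto simp: concat_replicate_alt)

text \<open>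
  The reflection list of \<open>s # u\<close> is \<open>s\<close> followed by the reflections of \<open>u\<close> conjugated by \<open>s\<close>.
  Conjugating the target \<open>r\<close> instead of the list makes the definition recursive in the word, with
  \<open>r\<close> kept as a word rather than as a group element.
\<close>

primrec refl_count :: "'a list \<Rightarrow> 'a list \<Rightarrow> nat" where
  "refl_count [] r = 0"
| "refl_count (s # u) r = (if [s] \<approx> r then 1 else 0) + refl_count u (s # r @ [s])"

lemma refl_count_cong:
  "u \<in> lists S \<Longrightarrow> r \<approx> r' \<Longrightarrow> refl_count u r = refl_count u r'"
proof (induction u arbitrary: r r')
  case (Cons s u)
  then have s: "s \<in> S" "u \<in> lists S" by auto
  have "s # r @ [s] \<approx> s # r' @ [s]"
    using cox_eq_context[OF Cons.prems(2), of "[s]" "[s]"] s by simp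
  moreover have "[s] \<approx> r \<longleftrightarrow> [s] \<approx> r'"
    using Cons.prems(2) by (meson cox_eq.sym cox_eq.trans)
  ultimately show ?case using Cons.IH[OF s(2)] by simp
qed simp

lemma refl_count_append:
  "refl_count (u @ v) r = refl_count u r + refl_count v (rev u @ r @ u)"
  by (induction u arbitrary: r) auto

text \<open>
  The reflections listed by an alternating word are the alternating words of odd length with the
  same first letter.
\<close>

lemma refl_count_alt:
  assumes "s \<in> S" "t \<in> S" "r \<in> lists S"
  shows "refl_count (alt s t k) r = (\<Sum>i<k. if alt s t (2 * i + 1) \<approx> r then 1 else 0)"
  using assms
proof (induction k arbitrary: s t r)
  case (Suc k)
  have *: "alt t s (2 * i + 1) \<approx> s # r @ [s] \<longleftrightarrow> alt s t (2 * Suc i + 1) \<approx> r" for i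
  proof -
    have "alt t s (2 * i + 1) \<in> lists S"
      using Suc.prems(1,2) set_alt[of t s "2 * i + 1"] by auto
    then show ?thesis
      using conj_swap_iff[of s "alt t s (2 * i + 1)" r] Suc.prems alt_odd_Suc[of s t i]
      by (simp add: numeral_3_eq_3)
  qed
  have r: "s # r @ [s] \<in> lists S" using Suc.prems by auto
  have "refl_count (alt s t (Suc k)) r =
      (if alt s t 1 \<approx> r then 1 else 0) + refl_count (alt t s k) (s # r @ [s])"
    by simp
  also have "\<dots> = (if alt s t (2 * 0 + 1) \<approx> r then 1 else 0) +
      (\<Sum>i<k. if alt s t (2 * Suc i + 1) \<approx> r then 1 else 0)"
    by (subst Suc.IH[OF Suc.prems(2,1) r], subst *) simp
  also have "\<dots> = (\<Sum>i<Suc k. if alt s t (2 * i + 1) \<approx> r then 1 else 0)"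
    by (subst sum.lessThan_Suc_shift) simp
  finally show ?case .
qed simp

text \<open>
  The \<open>i\<close>-th and the \<open>(i + m)\<close>-th reflection of \<open>(s t)^m\<close> are alternating words that differ by
  the prefix \<open>(s t)^m\<close>, so they are equal in the group and every reflection is listed an even
  number of times.
\<close>

lemma even_refl_count_relator:
  assumes s: "s \<in> S" "t \<in> S" and r: "r \<in> lists S"
  shows "even (refl_count (concat (replicate (m s t) [s, t])) r)"
proof -
  let ?f = "\<lambda>i. (if alt s t (2 * i + 1) \<approx> r then 1 else 0) :: nat"
  have per: "?f (i + m s t) = ?f i" for i
  proof -
    have "alt s t (2 * i + 1) \<in> lists S"
      using s set_alt[of s t "2 * i + 1"] by auto
    then have "alt s t (2 * m s t) @ alt s t (2 * i + 1) \<approx> alt s t (2 * i + 1)"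
      using cox_eq_context[OF cox_eq.relator[OF s], of "[]"] by (simp add: concat_replicate_alt)
    then have "alt s t (2 * (i + m s t) + 1) \<approx> alt s t (2 * i + 1)"
      using alt_even_add[of s t "m s t" "2 * i + 1"] by (simp add: algebra_simps)
    then show ?thesis
      by (smt (verit) cox_eq.sym cox_eq.trans)
  qed
  have "refl_count (concat (replicate (m s t) [s, t])) r = (\<Sum>i<m s t + m s t. ?f i)"
    using refl_count_alt[OF s r, of "m s t + m s t"] by (simp add: concat_replicate_alt mult_2)
  also have "\<dots> = (\<Sum>i<m s t. ?f i) + (\<Sum>i<m s t. ?f (i + m s t))"
    by (simp only: lessThan_atLeast0 sum.atLeastLessThan_concat[symmetric, of 0 "m s t" "m s t + m s t"]
        le_add1 zero_le sum.shift_bounds_nat_ivl[of _ 0 "m s t" "m s t", simplified])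
  also have "\<dots> = 2 * (\<Sum>i<m s t. ?f i)"
    by (subst per) simp
  finally show ?thesis by simp
qed

text \<open>
  Parities add up along concatenation, with the target conjugated by the first factor; so the
  relators are the only case of the congruence in which something happens.
\<close>

lemma refl_count_parity:
  "u \<approx> v \<Longrightarrow> r \<in> lists S \<Longrightarrow> even (refl_count u r) = even (refl_count v r)"
proof (induction arbitrary: r rule: cox_eq.induct)
  case (relator s t)
  then show ?case using even_refl_count_relator by simp
next
  case (append u v u' v')
  have w: "u \<in> lists S" "v \<in> lists S" "u' \<in> lists S" "v' \<in> lists S"
    using append.hyps cox_eq_words by blast+
  have "rev u @ r @ u \<approx> rev v @ r @ v"
    using append.hyps(1) cox_eq_rev append.prems by (meson cox_eq.append cox_eq.refl)
  then have "refl_count u' (rev u @ r @ u) = refl_count u' (rev v @ r @ v)"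
    using refl_count_cong w(3) by blast
  moreover have "rev v @ r @ v \<in> lists S"
    using w append.prems by auto
  ultimately show ?case
    using append.IH(1)[OF append.prems] append.IH(2)[of "rev v @ r @ v"]
    by (simp add: refl_count_append)
qed auto

text \<open>
  The conclusion says that \<open>r\<close> is the reflection \<open>a y a\<^sup>-\<^sup>1\<close> listed at the letter \<open>y\<close>, written
  without inverses.
\<close>

lemma refl_count_pos:
  assumes "u \<in> lists S" "r \<in> lists S" "refl_count u r > 0"
  shows "\<exists>a y b. u = a @ y # b \<and> a @ [y] \<approx> r @ a"
  using assms
proof (induction u arbitrary: r rule: list.induct)
  case (Cons s u)
  then have s: "s \<in> S" "u \<in> lists S" by auto
  show ?case
  proof (cases "[s] \<approx> r")
    case True
    then show ?thesis by (intro exI[of _ "[]"]) auto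
  next
    case False
    have "s # r @ [s] \<in> lists S" using s Cons.prems by auto
    moreover have "0 < refl_count u (s # r @ [s])"
      using Cons.prems(3) False by simp
    ultimately obtain a y b where ab: "u = a @ y # b" "a @ [y] \<approx> (s # r @ [s]) @ a"
      using Cons.IH[OF s(2)] by blast
    have "(s # a) @ [y] \<approx> r @ (s # a)"
      using Cons_swap_iff[of s "a @ [y]" "r @ s # a"] ab s Cons.prems(2) by auto
    then show ?thesis using ab(1) by (metis append_Cons)
  qed
qed simp

text \<open>
  If the reflections listed at \<open>x\<close> and at \<open>y\<close> agree, then multiplying the word by this reflection
  twice deletes both letters.
\<close>

lemma refl_count_ge_two:
  assumes "u \<in> lists S" "r \<in> lists S" "refl_count u r \<ge> 2"
  shows "\<exists>a x b y c. u = a @ x # b @ y # c \<and> u \<approx> a @ b @ c"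
  using assms
proof (induction u arbitrary: r rule: list.induct)
  case (Cons s u)
  then have s: "s \<in> S" "u \<in> lists S" by auto
  have r: "s # r @ [s] \<in> lists S" using s Cons.prems by auto
  show ?case
  proof (cases "[s] \<approx> r")
    case True
    then have "refl_count u (s # r @ [s]) > 0"
      using Cons.prems(3) by simp
    then obtain a y b where ab: "u = a @ y # b" "a @ [y] \<approx> (s # r @ [s]) @ a"
      using refl_count_pos[OF s(2) r] by blast
    have w: "a \<in> lists S" "y \<in> S" "b \<in> lists S" using s ab(1) by auto
    have "s # a @ [y] \<approx> r @ s # a"
      using Cons_swap_iff[of s "a @ [y]" "r @ s # a"] ab s w Cons.prems(2) by auto
    also have "r @ s # a \<approx> [s] @ s # a"
      using True cox_eq_context[of r "[s]" "[]" "s # a"] s w by (auto intro: cox_eq.sym)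
    also (cox_eq.trans) have "[s] @ s # a \<approx> a"
      using square_cancel_Cons s w by simp
    finally (cox_eq.trans) have "s # a @ [y] \<approx> a" .
    then have "s # u \<approx> [] @ a @ b"
      using cox_eq_context[of "s # a @ [y]" a "[]" b] ab w by simp
    then show ?thesis using ab(1)
      by (intro exI[of _ "[]"] exI[of _ s] exI[of _ a] exI[of _ y] exI[of _ b]) simp
  next
    case False
    then have "refl_count u (s # r @ [s]) \<ge> 2" using Cons.prems(3) by simp
    then obtain a x b y c where abc: "u = a @ x # b @ y # c" "u \<approx> a @ b @ c"
      using Cons.IH[OF s(2) r] by blast
    then have "s # u = (s # a) @ x # b @ y # c" "s # u \<approx> (s # a) @ b @ c"
      using cox_eq_context[OF abc(2), of "[s]" "[]"] s by auto
    then show ?thesis by blast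
  qed
qed simp

end

section \<open>Reduced words and the exchange condition\<close>

context parabolic
begin

lemma lists_I_S: "u \<in> lists I \<Longrightarrow> u \<in> lists S"
  using I_subset lists_mono by blast

text \<open>
  Minimality among words over \<open>I\<close> only, matching the length function of the parabolic subgroup;
  the equality of words is that of the whole group.
\<close>

definition red :: "'a list \<Rightarrow> bool" where
  "red u \<longleftrightarrow> u \<in> lists I \<and> (\<forall>v \<in> lists I. u \<approx> v \<longrightarrow> length u \<le> length v)"

lemma red_lists: "red u \<Longrightarrow> u \<in> lists I"
  by (simp add: red_def)

lemma ex_red: 
  assumes "u \<in> lists I"
  shows "\<exists>v. red v \<and> u \<approx> v \<and> length v \<le> length u"
proof -
  let ?P = "\<lambda>v. v \<in> lists I \<and> u \<approx> v"
  have u: "?P u" using assms lists_I_S by (auto intro: cox_eq.refl)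
  obtain v where v: "?P v" "\<And>v'. ?P v' \<Longrightarrow> length v \<le> length v'"
    using ex_has_least_nat[of ?P u length] u by blast
  have "red v"
    using v unfolding red_def by (meson cox_eq.trans)
  then show ?thesis using v u by blast
qed

lemma red_transfer:
  assumes "red u" "u \<approx> v" "v \<in> lists I" "length v \<le> length u"
  shows "red v"
  using assms unfolding red_def by (meson cox_eq.trans le_trans)

lemma red_append: 
  assumes "red (a @ u @ b)"
  shows "red u"
proof -
  have w: "a \<in> lists I" "u \<in> lists I" "b \<in> lists I" using assms by (auto simp: red_def)
  have "length u \<le> length v" if v: "v \<in> lists I" "u \<approx> v" for v
  proof -
    have "a @ u @ b \<approx> a @ v @ b"
      using v w lists_I_S cox_eq_context by blast
    moreover have "a @ v @ b \<in> lists I" using w v by simp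
    ultimately have "length (a @ u @ b) \<le> length (a @ v @ b)"
      using assms unfolding red_def by blast
    then show ?thesis by simp
  qed
  then show ?thesis using w by (simp add: red_def)
qed

lemma red_rev: "red u \<Longrightarrow> red (rev u)"
  unfolding red_def
  by (metis cox_eq_rev length_rev in_lists_conv_set set_rev rev_rev_ident)

lemma red_refl_count_le_one:
  assumes "red u" "r \<in> lists S"
  shows "refl_count u r \<le> 1"
proof (rule ccontr)
  assume "\<not> ?thesis"
  then obtain a x b y c where abc: "u = a @ x # b @ y # c" "u \<approx> a @ b @ c"
    using refl_count_ge_two[of u r] assms lists_I_S[OF red_lists] by fastforce
  moreover have "a @ b @ c \<in> lists I" using red_lists[OF assms(1)] abc(1) by simp
  ultimately have "length u \<le> length (a @ b @ c)" using assms(1) unfolding red_def by blast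
  then show False using abc(1) by simp
qed

text \<open>
  Let \<open>v\<close> be a reduced word of \<open>x u\<close>. Then \<open>x # v\<close> is a reduced word of the same element as
  \<open>u\<close>, and it lists the reflection \<open>x\<close> exactly once, so \<open>u\<close> lists \<open>x\<close> as well, at some letter \<open>y\<close>
  which can therefore be deleted. The equation \<open>a y = x a\<close> is recorded because it identifies \<open>y\<close> in
  concrete words.
\<close>

lemma exchange:
  assumes u: "red u" and x: "x \<in> I" and nred: "\<not> red (x # u)"
  shows "\<exists>a y b. u = a @ y # b \<and> a @ [y] \<approx> x # a \<and> red (a @ b) \<and> x # u \<approx> a @ b"
proof -
  have wu: "u \<in> lists I" "u \<in> lists S" "x \<in> S" using u x lists_I_S red_lists I_subset by blast+
  then have xu: "x # u \<in> lists I" using x by simp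
  obtain v where v: "red v" "x # u \<approx> v" "length v \<le> length (x # u)"
    using ex_red[OF xu] by blast
  have wv: "v \<in> lists I" "v \<in> lists S" using v lists_I_S red_lists by blast+
  (* The length of v is at most that of x # u and has the same parity; it is not equal to it, as
     x # u is not reduced, so v is shorter than u. *)
  have "length v \<noteq> length (x # u)"
    using nred red_transfer[OF v(1) cox_eq.sym[OF v(2)] xu] by auto
  moreover have "even (length v) = even (length (x # u))"
    using cox_eq_even_length[OF v(2)] by simp
  ultimately have lv: "length (x # v) \<le> length u"
    using v(3) by (cases "length v = length u") auto
  have xv: "u \<approx> x # v"
    using Cons_swap_iff[of x u v] v(2) wu wv by simp
  have redxv: "red (x # v)"
    using red_transfer[OF u xv _ lv] x wv by simp
  have "[x] \<in> lists S" using wu by simp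
  then have "refl_count (x # v) [x] \<le> 1"
    using redxv red_refl_count_le_one by blast
  moreover have "refl_count (x # v) [x] \<ge> 1"
    using wu(3) by (simp add: cox_eq.refl)
  ultimately have "refl_count (x # v) [x] = 1" by linarith
  then have "odd (refl_count u [x])"
    using refl_count_parity[OF xv, of "[x]"] wu(3) by simp
  then have "refl_count u [x] > 0" by (cases "refl_count u [x]") auto
  then obtain a y b where ab: "u = a @ y # b" "a @ [y] \<approx> [x] @ a"
    using refl_count_pos[of u "[x]"] wu by auto
  have w: "a \<in> lists S" "y \<in> S" "b \<in> lists S" "a \<in> lists I" "b \<in> lists I"
    using wu ab by auto
  have "x # a @ [y] \<approx> a"
    using Cons_swap_iff[of x "a @ [y]" a] ab w wu by simp
  then have e: "x # u \<approx> a @ b"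
    using cox_eq_context[of "x # a @ [y]" a "[]" b] ab w by simp
  have "v \<approx> a @ b" using e v(2) by (meson cox_eq.sym cox_eq.trans)
  moreover have "length (x # v) = length u"
    using lv u xv wv x unfolding red_def by (metis Cons_in_lists_iff le_antisym)
  ultimately have "red (a @ b)"
    using red_transfer[OF v(1)] w ab(1) by simp
  then show ?thesis using ab e by auto
qed

end

section \<open>Braid and commutation relations\<close>

context coxeter
begin

lemma alt_append_rev: "alt s t k @ rev (alt t s k) = alt s t (2 * k)"
proof (induction k arbitrary: s t)
  case (Suc k)
  have "alt s t (Suc k) @ rev (alt t s (Suc k)) = s # alt t s (2 * k) @ [t]"
    using Suc[of t s] by simp
  also have "\<dots> = alt s t (2 * Suc k)"
    using alt_even_add[of t s k 1] by simp
  finally show ?case .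
qed simp

lemma alt_lists: "s \<in> S \<Longrightarrow> t \<in> S \<Longrightarrow> alt s t k \<in> lists S"
  using set_alt[of s t k] by auto

lemma braid_relation:
  assumes "s \<in> S" "t \<in> S"
  shows "alt s t (m s t) \<approx> alt t s (m s t)"
proof -
  have ra: "rev (alt t s (m s t)) \<in> lists S" "alt s t (m s t) \<in> lists S" "alt t s (m s t) \<in> lists S"
    using alt_lists[OF assms(2,1), of "m s t"] alt_lists[OF assms, of "m s t"] by auto
  have "alt s t (m s t) @ rev (alt t s (m s t)) \<approx> []"
    using cox_eq.relator[OF assms] by (simp add: alt_append_rev concat_replicate_alt)
  moreover have "alt t s (m s t) @ rev (alt t s (m s t)) \<approx> []"
    using cancel_rev ra by blast
  ultimately show ?thesis
    using cancel_right_iff[OF ra] by (meson cox_eq.sym cox_eq.trans)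
qed

lemma commute_two:
  assumes "s \<in> S" "t \<in> S" "m s t = 2"
  shows "[s, t] \<approx> [t, s]"
  using braid_relation[OF assms(1,2)] assms(3) by (simp add: numeral_2_eq_2)

lemma commute_word:
  assumes "x \<in> S" "a \<in> lists S" "\<forall>y\<in>set a. m x y = 2"
  shows "x # a \<approx> a @ [x]"
  using assms(2,3)
proof (induction a rule: list.induct)
  case (Cons y a)
  then have w: "y \<in> S" "a \<in> lists S" by auto
  have "x # y # a \<approx> y # x # a"
    using cox_eq_context[OF commute_two[of x y], of "[]" a] Cons.prems w assms(1) by simp
  moreover have "y # x # a \<approx> y # a @ [x]"
    using Cons w assms(1) cancel_left_Cons_iff by simp
  ultimately show ?case by (auto intro: cox_eq.trans)
qed (use assms(1) in \<open>auto intro: cox_eq.refl\<close>)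

lemma commute_words:
  assumes "p \<in> lists S" "q \<in> lists S" "\<forall>x\<in>set p. \<forall>y\<in>set q. m x y = 2"
  shows "p @ q \<approx> q @ p"
  using assms(1,3)
proof (induction p rule: list.induct)
  case (Cons x p)
  then have w: "x \<in> S" "p \<in> lists S" by auto
  have "x # p @ q \<approx> x # q @ p"
    using Cons w assms(2) by simp (simp add: cancel_left_Cons_iff)
  moreover have "x # q @ p \<approx> q @ x # p"
    using cox_eq_context[OF commute_word[of x q], of "[]" p] Cons.prems w assms(2) by simp
  ultimately show ?case by (auto intro: cox_eq.trans)
qed (use assms(2) in \<open>auto intro: cox_eq.refl\<close>)

end

section \<open>The integral representation and the orders of products of generators\<close>

text \<open>
  A Cartan matrix satisfies \<open>A s t * A t s = 4 cos\<^sup>2(\<pi> / m s t)\<close>, which is 0, 1, 2 for the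
  exponents 2, 3, 4. Integral entries with product 2 cannot be symmetric, whence the two
  possibilities for exponent 4.
\<close>

locale cartan = coxeter S m for S :: "'a set" and m +
  fixes A :: "'a \<Rightarrow> 'a \<Rightarrow> int"
  assumes A_diag: "s \<in> S \<Longrightarrow> A s s = 2"
    and A_edge: "s \<in> S \<Longrightarrow> t \<in> S \<Longrightarrow> s \<noteq> t \<Longrightarrow>
      m s t = 2 \<and> A s t = 0 \<and> A t s = 0 \<or>
      m s t = 3 \<and> A s t = -1 \<and> A t s = -1 \<or>
      m s t = 4 \<and> (A s t = -1 \<and> A t s = -2 \<or> A s t = -2 \<and> A t s = -1)"
begin

text \<open>
  The action of a generator on the coefficient functions of the dual geometric representation,
  also known as a move of the numbers game.
\<close>

definition fire :: "'a \<Rightarrow> ('a \<Rightarrow> int) \<Rightarrow> 'a \<Rightarrow> int" where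
  "fire s f = (\<lambda>x. f x - A s x * f s)"

definition act :: "'a list \<Rightarrow> ('a \<Rightarrow> int) \<Rightarrow> 'a \<Rightarrow> int" where
  "act u f = foldr fire u f"

lemma act_simps [simp]: "act [] f = f" "act (s # u) f = fire s (act u f)"
  "act (u @ v) f = act u (act v f)"
  by (auto simp: act_def)

lemma act_relator:
  assumes "s \<in> S" "t \<in> S"
  shows "act (concat (replicate (m s t) [s, t])) f = f"
proof (cases "s = t")
  case True
  then show ?thesis
    using assms m_diag A_diag by (auto simp: fire_def algebra_simps)
next
  case False
  then show ?thesis
    using A_edge[OF assms False] A_diag[OF assms(1)] A_diag[OF assms(2)]
    by (elim disjE conjE) (auto simp: fire_def eval_nat_numeral algebra_simps)
qed

lemma act_cong: "u \<approx> v \<Longrightarrow> act u f = act v f"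
proof (induction arbitrary: f rule: cox_eq.induct)
  case (relator s t)
  then show ?case using act_relator by simp
qed simp_all

text \<open>
  The indicator function of \<open>x\<close> vanishes at all other generators, so these fix it, whereas \<open>x\<close>
  changes its sign at \<open>x\<close>.
\<close>

lemma generator_not_in_word:
  assumes "x \<in> S" "v \<in> lists S" "x \<notin> set v"
  shows "\<not> [x] \<approx> v"
proof
  let ?d = "\<lambda>y. if y = x then 1 else 0 :: int"
  assume "[x] \<approx> v"
  then have "act [x] ?d = act v ?d" by (rule act_cong)
  moreover have "act v ?d = ?d"
    using assms(2,3) by (induction v rule: list.induct) (auto simp: fire_def)
  ultimately have "fire x ?d x = 1" by simp
  then show False using A_diag[OF assms(1)] by (simp add: fire_def)
qed

text \<open>
  The two alternating words already act differently on the indicator functions of \<open>s\<close> and \<open>t\<close>.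
\<close>

lemma alt_neq:
  assumes "s \<in> S" "t \<in> S" "s \<noteq> t" "0 < k" "k < m s t"
  shows "\<not> alt s t k \<approx> alt t s k"
proof
  assume "alt s t k \<approx> alt t s k"
  then have *: "act (alt s t k) f x = act (alt t s k) f x" for f x
    using act_cong by metis
  let ?s = "\<lambda>y. if y = s then 1 else 0 :: int" and ?t = "\<lambda>y. if y = t then 1 else 0 :: int"
  have "m s t \<le> 4" using A_edge[OF assms(1-3)] by auto
  then have "k = 1 \<or> k = 2 \<or> k = 3" using assms(4,5) by auto
  then show False
    using *[of ?s s] *[of ?s t] *[of ?t s] *[of ?t t] assms(3,5)
      A_edge[OF assms(1-3)] A_diag[OF assms(1)] A_diag[OF assms(2)]
    by (elim disjE conjE) (auto simp: fire_def eval_nat_numeral)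
qed

text \<open>
  Only the first letter of a short alternating word can be exchanged: \<open>x\<close> lies in the subgroup
  generated by \<open>s\<close> and \<open>t\<close>, hence is one of them, and any other position would make two
  alternating words with fewer than \<open>m s t\<close> letters and different first letters equal.
\<close>

lemma alt_exchange:
  assumes s: "s \<in> S" "t \<in> S" "s \<noteq> t" and x: "x \<in> S"
    and a: "a @ [y] = alt s t (Suc j)" and j: "Suc j < m s t" and e: "a @ [y] \<approx> x # a"
  shows "a = [] \<and> x = s"
proof -
  have la: "length a = j" using arg_cong[OF a, of length] by simp
  have "a = take j (alt s t (Suc j))" using a la by (metis append_eq_conv_conj)
  then have a2: "a = alt s t j" by (simp only: take_alt) (simp add: min_def)
  have w: "a @ [y] \<in> lists S" "a \<in> lists S" "rev a \<in> lists S"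
    using alt_lists[OF s(1,2), of "Suc j"] alt_lists[OF s(1,2), of j] a a2 by (auto simp del: alt.simps)
  have "(a @ [y]) @ rev a \<approx> [x] @ a @ rev a"
    using cox_eq_context[OF e, of "[]" "rev a"] w by simp
  moreover have "[x] @ a @ rev a \<approx> [x]"
    using cox_eq_context[OF cancel_rev[OF w(2)], of "[x]" "[]"] x by simp
  ultimately have "[x] \<approx> (a @ [y]) @ rev a"
    by (meson cox_eq.sym cox_eq.trans)
  moreover have "(a @ [y]) @ rev a \<in> lists S" using w by simp
  ultimately have "x \<in> set (a @ [y])"
    using generator_not_in_word[OF x] by fastforce
  then have "x = s \<or> x = t" using set_alt[of s t "Suc j"] a by auto
  then show ?thesis
  proof
    assume xs: "x = s"
    have "alt s t (Suc j) \<approx> s # alt s t j" using e a a2 xs by simp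
    then have "alt t s j \<approx> alt s t j"
      using cancel_left_Cons_iff alt_lists s by simp
    then have "j = 0"
      using alt_neq[OF s, of j] j cox_eq.sym by (cases j) auto
    then show ?thesis using a2 xs by simp
  next
    assume "x = t"
    then have "alt s t (Suc j) \<approx> alt t s (Suc j)" using e a a2 by simp
    then show ?thesis using alt_neq[OF s _ j] by blast
  qed
qed

end

section \<open>Full commutativity in terms of words\<close>

context parabolic
begin

lemma cls_eq: "u \<in> lists I \<Longrightarrow> cls u = cls v \<longleftrightarrow> u \<approx> v"
  using cls_eq_iff lists_I_S by blast

lemma word_prod_cls: "u \<in> lists I \<Longrightarrow> word_prod u = cls u"
  using word_prod_eq_cls lists_I_S by blast

lemma gen_mult_cls: "s \<in> I \<Longrightarrow> u \<in> lists I \<Longrightarrow> gen s \<otimes>\<^bsub>W\<^esub> cls u = cls (s # u)"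
  using mult_cls[of "[s]" u] lists_I_S[of u] I_subset by (auto simp: gen_def)

lemma cls_mult_gen: "s \<in> I \<Longrightarrow> u \<in> lists I \<Longrightarrow> cls u \<otimes>\<^bsub>W\<^esub> gen s = cls (u @ [s])"
  using mult_cls[of u "[s]"] lists_I_S[of u] I_subset by (auto simp: gen_def)

lemma P_eq: "P = cls ` lists I"
proof
  have gen_inv: "inv\<^bsub>W\<^esub> (gen s) = gen s" if "s \<in> I" for s
  proof -
    have s: "s \<in> S" "[s] \<in> lists S" using that I_subset by auto
    have "gen s \<otimes>\<^bsub>W\<^esub> gen s = \<one>\<^bsub>W\<^esub>"
      using mult_cls[OF s(2) s(2)] cls_eq_iff[of "[s, s]" "[]"] square_cancel s
      by (simp add: gen_def W_def)
    moreover have "gen s \<in> carrier W" using s by (simp add: gen_def W_def)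
    ultimately show ?thesis using group.inv_equality[OF group_W] by blast
  qed
  show "P \<subseteq> cls ` lists I"
  proof
    fix w assume "w \<in> P"
    then have "w \<in> generate W (gen ` I)" by (simp add: P_def)
    then show "w \<in> cls ` lists I"
    proof (induction rule: generate.induct)
      case one
      then show ?case by (auto simp: W_def)
    next
      case (incl h)
      then show ?case by (auto simp: gen_def)
    next
      case (inv h)
      then show ?case using gen_inv by (auto simp: gen_def)
    next
      case (eng h1 h2)
      then obtain u v where "u \<in> lists I" "v \<in> lists I" "h1 = cls u" "h2 = cls v" by auto
      then show ?case
        using mult_cls[of u v] lists_I_S by (intro image_eqI[of _ _ "u @ v"]) auto
    qed
  qed
  show "cls ` lists I \<subseteq> P"
  proof
    fix w assume "w \<in> cls ` lists I"
    then obtain u where u: "u \<in> lists I" "w = cls u" by auto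
    from u(1) have "cls u \<in> generate W (gen ` I)"
    proof (induction u rule: list.induct)
      case Nil
      then show ?case using generate.one[of W] by (simp add: W_def)
    next
      case (Cons s u)
      then show ?case
        using generate.eng[of "gen s" W "gen ` I" "cls u"] generate.incl[of "gen s" "gen ` I" W]
          gen_mult_cls[of s u] by auto
    qed
    then show "w \<in> P" by (simp add: P_def u(2))
  qed
qed

lemma len_red:
  assumes "red u"
  shows "len (cls u) = length u"
  unfolding len_def
proof (rule Least_equality)
  show "\<exists>v\<in>lists I. word_prod v = cls u \<and> length v = length u"
    using assms red_lists word_prod_cls by blast
next
  fix k assume "\<exists>v\<in>lists I. word_prod v = cls u \<and> length v = k"
  then obtain v where v: "v \<in> lists I" "word_prod v = cls u" "length v = k" by blast
  then have "u \<approx> v" using word_prod_cls cls_eq red_lists[OF assms] by metis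
  then show "length u \<le> k" using assms v unfolding red_def by blast
qed

lemma reduced_expr_iff:
  assumes "u \<in> lists I"
  shows "reduced_expr v (cls u) \<longleftrightarrow> red v \<and> u \<approx> v"
proof -
  obtain r where r: "red r" "u \<approx> r" using ex_red[OF assms] by blast
  have cr: "cls u = cls r" using cls_eq[OF assms] r by simp
  show ?thesis
  proof
    assume *: "reduced_expr v (cls u)"
    then have v: "v \<in> lists I" "cls v = cls r" "length v = length r"
      unfolding reduced_expr_def using word_prod_cls[of v] cr len_red[OF r(1)] by simp_all
    have rv: "r \<approx> v" using v cls_eq red_lists[OF r(1)] by metis
    then show "red v \<and> u \<approx> v"
      using red_transfer[OF r(1) rv] v r cox_eq.trans by auto
  next
    assume "red v \<and> u \<approx> v"
    then show "reduced_expr v (cls u)"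
      unfolding reduced_expr_def using red_lists word_prod_cls cls_eq[OF assms] len_red by metis
  qed
qed

text \<open>
  By exchange, a word that stops being reduced with a new first letter represents an element of
  smaller length, not merely of the same length.
\<close>

lemma left_descents_iff:
  assumes u: "red u" and s: "s \<in> I"
  shows "s \<in> left_descents (cls u) \<longleftrightarrow> \<not> red (s # u)"
proof -
  have su: "s # u \<in> lists I" using s red_lists[OF u] by simp
  have "len (cls (s # u)) < length u \<longleftrightarrow> \<not> red (s # u)"
  proof
    assume "len (cls (s # u)) < length u"
    then show "\<not> red (s # u)" using len_red[of "s # u"] by auto
  next
    assume "\<not> red (s # u)"
    then obtain a y b where e: "u = a @ y # b" "red (a @ b)" "s # u \<approx> a @ b"
      using exchange[OF u s] by blast
    then have "cls (s # u) = cls (a @ b)" using cls_eq[OF su] by simp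
    then show "len (cls (s # u)) < length u" using len_red[OF e(2)] e(1) by simp
  qed
  then show ?thesis
    using s gen_mult_cls[OF s red_lists[OF u]] len_red[OF u] by (simp add: left_descents_def)
qed

lemma commutation_sym: "commutation u v \<Longrightarrow> commutation v u"
proof (induction rule: commutation.induct)
  case (1 s t u v)
  then show ?case using commutation.intros[of t s u v] m_sym[of s t] I_subset by auto
qed

lemma commutations_sym: "commutation\<^sup>*\<^sup>* u v \<Longrightarrow> commutation\<^sup>*\<^sup>* v u"
  by (induction rule: rtranclp_induct)
    (auto intro: commutation_sym converse_rtranclp_into_rtranclp)

lemma commutation_context: "commutation u v \<Longrightarrow> commutation (a @ u @ b) (a @ v @ b)"
proof (induction rule: commutation.induct)
  case (1 s t u v)
  then show ?case using commutation.intros[of s t "a @ u" "v @ b"] by simp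
qed

lemma commutations_context: "commutation\<^sup>*\<^sup>* u v \<Longrightarrow> commutation\<^sup>*\<^sup>* (a @ u @ b) (a @ v @ b)"
  by (induction rule: rtranclp_induct) (auto dest: commutation_context[of _ _ a b])

lemma commutation_rev: "commutation u v \<Longrightarrow> commutation (rev u) (rev v)"
proof (induction rule: commutation.induct)
  case (1 s t u v)
  then show ?case
    using commutation.intros[of t s "rev v" "rev u"] m_sym[of s t] I_subset by auto
qed

lemma commutations_rev: "commutation\<^sup>*\<^sup>* u v \<Longrightarrow> commutation\<^sup>*\<^sup>* (rev u) (rev v)"
  by (induction rule: rtranclp_induct) (auto dest: commutation_rev)

lemma commutation_set: "commutation u v \<Longrightarrow> set u = set v"
  by (induction rule: commutation.induct) auto

lemma commutations_set: "commutation\<^sup>*\<^sup>* u v \<Longrightarrow> set u = set v"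
  by (induction rule: rtranclp_induct) (auto dest: commutation_set)

text \<open>
  Letters with \<open>m s t \<noteq> 2\<close> are never swapped with each other. This invariant separates the two sides
  of a braid relation.
\<close>

lemma commutation_filter:
  assumes "commutation u v" "s \<in> S" "t \<in> S" "m s t \<noteq> 2"
  shows "filter (\<lambda>x. x = s \<or> x = t) u = filter (\<lambda>x. x = s \<or> x = t) v"
  using assms
proof (induction rule: commutation.induct)
  case (1 x y u v)
  then have "x \<in> S" "y \<in> S" using I_subset by auto
  then have "x \<noteq> y" using m_diag[of x] 1 by auto
  then have "\<not> ((x = s \<or> x = t) \<and> (y = s \<or> y = t))"
    using 1 m_sym[of s t] by auto
  then show ?case by auto
qed

lemma commutations_filter:
  assumes "commutation\<^sup>*\<^sup>* u v" "s \<in> S" "t \<in> S" "m s t \<noteq> 2"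
  shows "filter (\<lambda>x. x = s \<or> x = t) u = filter (\<lambda>x. x = s \<or> x = t) v"
  using assms(1) by (induction rule: rtranclp_induct) (auto dest: commutation_filter[OF _ assms(2-4)])

lemma commutations_move:
  assumes "x \<in> I" "a \<in> lists I" "\<forall>y\<in>set a. m x y = 2"
  shows "commutation\<^sup>*\<^sup>* (x # a) (a @ [x])"
  using assms(2,3)
proof (induction a rule: list.induct)
  case (Cons y a)
  then have "commutation (x # y # a) (y # x # a)"
    using commutation.intros[of x y "[]" a] assms(1) by simp
  moreover have "commutation\<^sup>*\<^sup>* (y # x # a) (y # a @ [x])"
    using commutations_context[of "x # a" "a @ [x]" "[y]" "[]"] Cons by simp
  ultimately show ?case by simp
qed simp

lemma mem_Wc_iff:
  assumes "red u"
  shows "cls u \<in> Wc \<longleftrightarrow> (\<forall>v. red v \<longrightarrow> u \<approx> v \<longrightarrow> commutation\<^sup>*\<^sup>* u v)"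
proof -
  have u: "u \<in> lists I" using red_lists[OF assms] .
  have "cls u \<in> P" using u by (simp add: P_eq)
  moreover have "u \<approx> u" using u lists_I_S cox_eq.refl by blast
  ultimately show ?thesis
    using assms unfolding Wc_def fully_commutative_def
    by (auto simp: reduced_expr_iff[OF u] intro: rtranclp_trans commutations_sym)
qed

lemma braid_not_in_Wc:
  assumes r: "red (a @ alt s t (m s t) @ b)" and st: "s \<in> I" "t \<in> I" "3 \<le> m s t"
  shows "cls (a @ alt s t (m s t) @ b) \<notin> Wc"
proof
  let ?u = "a @ alt s t (m s t) @ b" and ?v = "a @ alt t s (m s t) @ b"
  assume "cls ?u \<in> Wc"
  have S: "s \<in> S" "t \<in> S" using st I_subset by auto
  have ne: "s \<noteq> t" using m_diag[OF S(1)] st by auto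
  have w: "a \<in> lists I" "b \<in> lists I" using red_lists[OF r] by auto
  have e: "?u \<approx> ?v"
    using cox_eq_context[OF braid_relation[OF S]] w lists_I_S by blast
  have "?v \<in> lists I" using w set_alt[of t s "m s t"] st by auto
  then have "red ?v" using red_transfer[OF r e] by simp
  then have "commutation\<^sup>*\<^sup>* ?u ?v" using \<open>cls ?u \<in> Wc\<close> mem_Wc_iff[OF r] e by blast
  then have "filter (\<lambda>x. x = s \<or> x = t) ?u = filter (\<lambda>x. x = s \<or> x = t) ?v"
    using commutations_filter S st(3) by fastforce
  moreover have "filter (\<lambda>x. x = s \<or> x = t) (alt s t k) = alt s t k" for k
    using set_alt[of s t k] by (intro filter_True) auto
  moreover have "filter (\<lambda>x. x = s \<or> x = t) (alt t s k) = alt t s k" for k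
    using set_alt[of t s k] by (intro filter_True) auto
  ultimately have "alt s t (m s t) = alt t s (m s t)" by simp
  then show False using ne st(3) by (cases "m s t") auto
qed

lemma cls_rev_in_Wc:
  assumes "red u" "cls u \<in> Wc"
  shows "cls (rev u) \<in> Wc"
  unfolding mem_Wc_iff[OF red_rev[OF assms(1)]]
proof (intro allI impI)
  fix v assume "red v" "rev u \<approx> v"
  then have "red (rev v)" "u \<approx> rev v" using red_rev cox_eq_rev[of "rev u" v] by auto
  then have "commutation\<^sup>*\<^sup>* u (rev v)" using assms mem_Wc_iff by blast
  then show "commutation\<^sup>*\<^sup>* (rev u) v" using commutations_rev[of u "rev v"] by simp
qed

lemma cls_rev_in_Wc_iff:
  assumes "u \<in> lists I"
  shows "cls (rev u) \<in> Wc \<longleftrightarrow> cls u \<in> Wc"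
proof -
  obtain r where r: "red r" "u \<approx> r" using ex_red[OF assms] by blast
  have "cls u = cls r" "cls (rev u) = cls (rev r)"
    using cls_eq[OF assms, of r] cls_eq[of "rev u" "rev r"] r cox_eq_rev[of u r] assms
    by (simp_all add: in_lists_conv_set)
  then show ?thesis
    using cls_rev_in_Wc[OF r(1)] cls_rev_in_Wc[OF red_rev[OF r(1)]] by auto
qed

lemma len_cls_rev:
  assumes "u \<in> lists I"
  shows "len (cls (rev u)) = len (cls u)"
proof -
  obtain r where r: "red r" "u \<approx> r" using ex_red[OF assms] by blast
  have "cls u = cls r" "cls (rev u) = cls (rev r)"
    using cls_eq[OF assms, of r] cls_eq[of "rev u" "rev r"] r cox_eq_rev[of u r] assms
    by (simp_all add: in_lists_conv_set)
  then show ?thesis using len_red[OF r(1)] len_red[OF red_rev[OF r(1)]] by simp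
qed

text \<open>
  Reversing words is inversion in the group, so each statement about left reducibility gives one
  about right reducibility.
\<close>

lemma right_reducible_iff_rev:
  assumes u: "u \<in> lists I" and st: "s \<in> I" "t \<in> I"
  shows "right_weak_star_reducible s t (cls u) \<longleftrightarrow> left_weak_star_reducible s t (cls (rev u))"
proof -
  have ru: "rev u \<in> lists I" using u by auto
  have d: "x \<in> right_descents (cls v) \<longleftrightarrow> x \<in> left_descents (cls (rev v))"
    if "x \<in> I" "v \<in> lists I" for x v
  proof -
    have rv: "rev v \<in> lists I" using that by auto
    show ?thesis
      using len_cls_rev[of "v @ [x]"] len_cls_rev[of v] that
      by (simp add: right_descents_def left_descents_def cls_mult_gen gen_mult_cls rv)
  qed
  have "cls u \<otimes>\<^bsub>W\<^esub> gen s = cls (u @ [s])" "cls u \<otimes>\<^bsub>W\<^esub> gen t = cls (u @ [t])"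
    "gen s \<otimes>\<^bsub>W\<^esub> cls (rev u) = cls (rev (u @ [s]))"
    "gen t \<otimes>\<^bsub>W\<^esub> cls (rev u) = cls (rev (u @ [t]))"
    using cls_mult_gen gen_mult_cls[OF _ ru] u st by auto
  moreover have "u @ [s] \<in> lists I" "u @ [t] \<in> lists I" using u st by auto
  ultimately show ?thesis
    unfolding right_weak_star_reducible_def left_weak_star_reducible_def
    using d[OF st(1) u] d[OF st(2), of "u @ [s]"] cls_rev_in_Wc_iff[of "u @ [t]"] by presburger
qed

end

section \<open>Weak star reducibility and commuting products\<close>

locale parabolic_cartan = parabolic S m I + cartan S m A
  for S :: "'a set" and m and I and A
begin

text \<open>
  The descent conditions are read off from the prefix; the point is that \<open>t w \<notin> W\<^sub>c\<close>. If the word \<open>t # u\<close> is reduced, it starts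
  with an alternating factor of length \<open>m s t\<close>. Otherwise \<open>t\<close> can be exchanged with a letter of
  \<open>u\<close>. This letter is not in the alternating prefix, so after the exchange \<open>t\<close> stands in front of
  the prefix, and \<open>u\<close> itself has a reduced word with the alternating factor.
\<close>

lemma left_reducible_if_prefix:
  assumes u: "red u" and uv: "u = alt s t (m s t - 1) @ v" and st: "s \<in> I" "t \<in> I" "3 \<le> m s t"
    and fc: "cls u \<in> Wc"
  shows "left_weak_star_reducible s t (cls u)"
proof -
  have S: "s \<in> S" "t \<in> S" using st I_subset by auto
  have ne: "s \<noteq> t" using m_diag[OF S(1)] st by auto
  have sym: "m t s = m s t" using m_sym S by simp
  obtain k where k: "m s t - 1 = Suc k" "k \<ge> 1" "m s t = Suc (Suc k)"
    using st(3) by (metis One_nat_def Suc_diff_le Suc_le_mono diff_Suc_1 numeral_3_eq_3 old.nat.exhaust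
        Suc_leD not_less_eq_eq le0)
  have w: "v \<in> lists I" "u \<in> lists I" using red_lists[OF u] uv by auto
  have u1: "u = s # alt t s k @ v" using uv k by simp
  have r1: "red (alt t s k @ v)" using red_append[of "[s]" "alt t s k @ v" "[]"] u u1 by simp
  have w1: "alt t s k @ v \<in> lists I" using red_lists[OF r1] .
  obtain k' where k': "k = Suc k'" using k(2) by (cases k) auto
  have r2: "red (alt s t k' @ v)" using red_append[of "[t]" "alt s t k' @ v" "[]"] r1 k' by simp
  have sq: "x # x # z \<approx> z" if "x \<in> I" "z \<in> lists I" for x z
    using square_cancel_Cons that lists_I_S I_subset by blast
  have not_red_double: "\<not> red (x # x # z)" if "x \<in> I" "z \<in> lists I" for x z
    using sq[OF that] that unfolding red_def by force
  have "s \<in> left_descents (cls u)"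
    using left_descents_iff[OF u st(1)] not_red_double[OF st(1) w1] u1 by simp
  moreover have g: "gen s \<otimes>\<^bsub>W\<^esub> cls u = cls (alt t s k @ v)"
    using gen_mult_cls[OF st(1) w(2)] sq[OF st(1) w1] cls_eq[of "s # u"] st w u1 by simp
  moreover have "t \<in> left_descents (cls (alt t s k @ v))"
    using left_descents_iff[OF r1 st(2)] not_red_double[OF st(2) red_lists[OF r2]] k' by simp
  moreover have "gen t \<otimes>\<^bsub>W\<^esub> cls u = cls (t # u)"
    using gen_mult_cls st w by simp
  moreover have "cls (t # u) \<notin> Wc"
  proof
    assume fct: "cls (t # u) \<in> Wc"
    have tu: "t # u = alt t s (m t s) @ v" using uv k sym by simp
    show False
    proof (cases "red (t # u)")
      case True
      then show False
        using braid_not_in_Wc[of "[]" t s v] fct tu st sym by simp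
    next
      case False
      then obtain a y b where e: "u = a @ y # b" "a @ [y] \<approx> t # a" "red (a @ b)" "t # u \<approx> a @ b"
        using exchange[OF u st(2)] by blast
      show False
      proof (cases "length a < m s t - 1")
        case True
        have "\<exists>c. alt s t (m s t - 1) = a @ y # c"
        proof -
          have "a @ y # b = alt s t (m s t - 1) @ v" using e(1) uv by simp
          from arg_cong[OF this, of "take (Suc (length a))"]
          have "take (Suc (length a)) (alt s t (m s t - 1)) = a @ [y]"
            using True by (simp del: take_alt)
          then show ?thesis
            by (metis append.assoc append_Cons append_Nil append_take_drop_id)
        qed
        then have "a @ [y] = alt s t (Suc (length a))" using alt_prefix_split by metis
        then have "t = s"
          using alt_exchange[OF S ne S(2), of a y "length a"] True e(2) by simp
        then show False using ne by simp
      next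
        case False
        have "a @ y # b = alt s t (m s t - 1) @ v" using e(1) uv by simp
        from arg_cong[OF this, of "take (m s t - 1)"]
        have "take (m s t - 1) a = alt s t (m s t - 1)"
          using False by (simp del: take_alt)
        then obtain a' where a': "a = alt s t (m s t - 1) @ a'"
          by (metis append_take_drop_id)
        have wab: "a @ b \<in> lists I" using red_lists[OF e(3)] .
        have "u \<approx> t # a @ b"
          using Cons_swap_iff[of t u "a @ b"] e(4) S lists_I_S wab w by simp
        then have "red (t # a @ b)" "cls u = cls (t # a @ b)"
          using red_transfer[OF u, of "t # a @ b"] wab st e(1) cls_eq[OF w(2)] by simp_all
        moreover have "t # a @ b = [] @ alt t s (m t s) @ (a' @ b)"
          using a' k sym by simp
        ultimately show False
          using braid_not_in_Wc[of "[]" t s "a' @ b"] fc st sym by metis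
      qed
    qed
  qed
  ultimately show ?thesis
    unfolding left_weak_star_reducible_def using st(3) by simp
qed

text \<open>
  The words \<open>q @ p\<close> with \<open>p\<close> a product of distinct commuting generators and \<open>q\<close> an alternating word
  too short for a braid relation whose two letters commute with \<open>p\<close>. All lengths of \<open>q\<close> are
  allowed so that the class is closed under removing letters.
\<close>

definition normal_form :: "'a list \<Rightarrow> 'a list \<Rightarrow> bool" where
  "normal_form q p \<longleftrightarrow> p \<in> lists I \<and> distinct p \<and> (\<forall>x\<in>set p. \<forall>y\<in>set p. x \<noteq> y \<longrightarrow> m x y = 2) \<and>
    (q = [] \<or> (\<exists>s\<in>I. \<exists>t\<in>I. \<exists>j. s \<noteq> t \<and> q = alt s t j \<and> j < m s t \<and>
      (\<forall>x\<in>set p. m x s = 2 \<and> m x t = 2)))"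

lemma normal_form_commute: "normal_form q p \<Longrightarrow> x \<in> set p \<Longrightarrow> y \<in> set q \<Longrightarrow> m x y = 2"
  unfolding normal_form_def using set_alt by fastforce

lemma normal_form_lists: "normal_form q p \<Longrightarrow> q \<in> lists I \<and> p \<in> lists I"
  unfolding normal_form_def using set_alt by fastforce

lemma normal_form_tl: 
  assumes "normal_form (x # q) p"
  shows "normal_form q p"
proof -
  obtain s t j where *: "s \<in> I" "t \<in> I" "s \<noteq> t" "x # q = alt s t j" "j < m s t"
    "\<forall>x\<in>set p. m x s = 2 \<and> m x t = 2"
    using assms unfolding normal_form_def by auto
  obtain j' where j': "j = Suc j'" "q = alt t s j'" using *(4) by (cases j) auto
  have "m t s = m s t" using *(1,2) I_subset m_sym by blast
  then have "t \<noteq> s \<and> q = alt t s j' \<and> j' < m t s \<and> (\<forall>x\<in>set p. m x t = 2 \<and> m x s = 2)"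
    using * j' by auto
  then show ?thesis
    using assms *(1,2) unfolding normal_form_def by blast
qed

lemma normal_form_remove:
  assumes "normal_form q (a @ y # b)"
  shows "normal_form q (a @ b)"
proof -
  have "q = [] \<or> (\<exists>s\<in>I. \<exists>t\<in>I. \<exists>j. s \<noteq> t \<and> q = alt s t j \<and> j < m s t \<and>
      (\<forall>x\<in>set (a @ b). m x s = 2 \<and> m x t = 2))"
  proof (cases "q = []")
    case False
    then obtain s t j where *: "s \<in> I" "t \<in> I" "s \<noteq> t \<and> q = alt s t j \<and> j < m s t"
      "\<forall>x\<in>set (a @ y # b). m x s = 2 \<and> m x t = 2"
      using assms unfolding normal_form_def by blast
    from *(4) have "\<forall>x\<in>set (a @ b). m x s = 2 \<and> m x t = 2" by simp
    then show ?thesis using *(1-3) by blast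
  qed simp
  moreover have "a @ b \<in> lists I \<and> distinct (a @ b) \<and>
      (\<forall>x\<in>set (a @ b). \<forall>z\<in>set (a @ b). x \<noteq> z \<longrightarrow> m x z = 2)"
    using assms unfolding normal_form_def by (elim conjE) simp
  ultimately show ?thesis unfolding normal_form_def by (elim conjE) (intro conjI; assumption)
qed

lemma normal_form_commute_prefix:
  assumes "normal_form q (a @ x # b)"
  shows "\<forall>z\<in>set (q @ a). m x z = 2"
proof
  fix z assume "z \<in> set (q @ a)"
  then consider "z \<in> set q" | "z \<in> set a" by auto
  then show "m x z = 2"
  proof cases
    case 1
    then show ?thesis using normal_form_commute[OF assms] by simp
  next
    case 2
    then have "z \<noteq> x" using assms unfolding normal_form_def by auto
    then show ?thesis using assms 2 unfolding normal_form_def by auto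
  qed
qed

text \<open>
  The generators that can come first are the first letter of \<open>q\<close> and the letters of \<open>p\<close>. In
  both cases the letter that is exchanged is the generator itself.
\<close>

lemma normal_form_exchange:
  assumes f: "normal_form q p" and x: "x \<in> I" and ab: "q @ p = a @ y # b" and e: "a @ [y] \<approx> x # a"
  shows "x = y \<and> (a = [] \<and> (\<exists>q'. q = x # q' \<and> b = q' @ p) \<or>
    (\<exists>a'. a = q @ a' \<and> p = a' @ x # b))"
proof (cases "length a < length q")
  case True
  then have "q \<noteq> []" by auto
  then obtain s t j where st: "s \<in> I" "t \<in> I" "s \<noteq> t" "q = alt s t j" "j < m s t"
    using f unfolding normal_form_def by blast
  have "take (length q) (a @ y # b) = q" using ab[symmetric] by simp
  then obtain c where c: "q = a @ y # c" using True
    by (metis append_take_drop_id drop_Cons' drop_append take_append take_Cons' 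
        append.simps take_all less_imp_le diff_is_0_eq neq0_conv zero_less_diff)
  have "a @ [y] = alt s t (Suc (length a))" using alt_prefix_split c st(4) by metis
  moreover have "Suc (length a) < m s t" using True st by simp
  ultimately have "a = [] \<and> x = s"
    using alt_exchange[of s t x a y "length a"] st x e I_subset by blast
  then show ?thesis using c st ab by (cases j) auto
next
  case False
  then obtain a' where a': "a = q @ a'" "p = a' @ y # b"
    using ab by (auto simp: append_eq_append_conv2 append_eq_Cons_conv)
  have w: "q \<in> lists I" "p \<in> lists I" using normal_form_lists[OF f] by auto
  have wS: "a \<in> lists S" "y \<in> S" "x \<in> S" using w a' lists_I_S[of a] x I_subset by auto
  have "\<forall>z\<in>set a. m y z = 2"
    using normal_form_commute_prefix f a' by simp
  then have "y # a \<approx> a @ [y]" using commute_word wS by blast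
  then have "[y] @ a \<approx> [x] @ a" using e by (auto intro: cox_eq.trans)
  then have "[x] \<approx> [y]"
    using cancel_right_iff[of a "[y]" "[x]"] wS cox_eq.sym by auto
  then have "x = y" using generator_not_in_word[of x "[y]"] wS by auto
  then show ?thesis using a' by auto
qed

lemma normal_form_red: "normal_form q p \<Longrightarrow> red (q @ p)"
proof (induction "length (q @ p)" arbitrary: q p rule: less_induct)
  case less
  have w: "q \<in> lists I" "p \<in> lists I" using normal_form_lists[OF less.prems] by auto
  show ?case
  proof (cases q)
    case Nil
    show ?thesis
    proof (cases p)
      case Nil
      then show ?thesis using \<open>q = []\<close> by (simp add: red_def)
    next
      case (Cons x p')
      have f': "normal_form [] p'" using normal_form_remove[of "[]" "[]" x p'] less.prems Nil Cons by simp
      then have r: "red p'" using less.hyps[of "[]" p'] Nil Cons by simp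
      have x: "x \<in> I" "x \<notin> set p'" using w Cons less.prems unfolding normal_form_def by auto
      show ?thesis
      proof (rule ccontr)
        assume "\<not> ?thesis"
        then obtain a y b where e: "p' = a @ y # b" "a @ [y] \<approx> x # a"
          using exchange[OF r x(1)] Nil Cons by auto
        have pe: "[] @ p' = a @ y # b" using e(1) by simp
        have "x = y" using normal_form_exchange[OF f' x(1) pe e(2)] by blast
        then show False using e(1) x(2) by simp
      qed
    qed
  next
    case (Cons x q')
    have f': "normal_form q' p" using normal_form_tl less.prems Cons by simp
    then have r: "red (q' @ p)" using less.hyps[of q' p] Cons by simp
    have x: "x \<in> I" using w Cons by auto
    show ?thesis
    proof (rule ccontr)
      assume "\<not> ?thesis"
      then obtain a y b where e: "q' @ p = a @ y # b" "a @ [y] \<approx> x # a"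
        using exchange[OF r x] Cons by auto
      then have "(\<exists>q''. q' = x # q'') \<or> (\<exists>a' b'. p = a' @ x # b')"
        using normal_form_exchange[OF f' x e] by blast
      then consider (1) q'' where "q' = x # q''" | (2) "x \<in> set p" by auto
      then show False
      proof cases
        case 1
        then obtain s t j where st: "s \<noteq> t" "x # x # q'' = alt s t j"
          using less.prems Cons unfolding normal_form_def by auto
        then obtain j' where "j = Suc (Suc j')" by (cases j rule: nat.exhaust; cases "j - 1") auto
        then show False using st by auto
      next
        case 2
        then show False
          using normal_form_commute[OF less.prems 2, of x] m_diag[of x] x I_subset Cons by auto
      qed
    qed
  qed
qed

text \<open>
  The first letter of any other reduced word can be exchanged into \<open>q @ p\<close>. There it is a letter
  that commutations move to the front, and what remains is again a word of this kind.
\<close>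

lemma normal_form_unique:
  "normal_form q p \<Longrightarrow> red v \<Longrightarrow> q @ p \<approx> v \<Longrightarrow> commutation\<^sup>*\<^sup>* v (q @ p)"
proof (induction v arbitrary: q p)
  case Nil
  then have "length (q @ p) \<le> 0"
    using normal_form_red[OF Nil.prems(1)] Nil.prems(3) unfolding red_def by (metis lists.Nil list.size(3))
  then show ?case by simp
next
  case (Cons x v)
  have w: "q \<in> lists I" "p \<in> lists I" using normal_form_lists[OF Cons.prems(1)] by auto
  then have wS: "q @ p \<in> lists S" using lists_I_S by simp
  have xv: "x \<in> I" "v \<in> lists I" "x \<in> S" "v \<in> lists S"
    using red_lists[OF Cons.prems(2)] lists_I_S I_subset by auto
  have rv: "red v" using red_append[of "[x]" v "[]"] Cons.prems(2) by simp
  have r: "red (q @ p)" using normal_form_red Cons.prems by simp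
  have e: "x # q @ p \<approx> v" using Cons_swap_iff[of x "q @ p" v] Cons.prems(3) wS xv by simp
  have "length (q @ p) \<le> length (x # v)" "length (x # v) \<le> length (q @ p)"
    using r Cons.prems w xv cox_eq.sym unfolding red_def
    by (meson append_in_lists_conv)+
  then have "\<not> red (x # q @ p)" using e xv unfolding red_def by force
  then obtain a y b where ab: "q @ p = a @ y # b" "a @ [y] \<approx> x # a" "x # q @ p \<approx> a @ b"
    using exchange[OF r xv(1)] by blast
  have vab: "a @ b \<approx> v" using ab(3) e by (meson cox_eq.sym cox_eq.trans)
  have "x = y" and "a = [] \<and> (\<exists>q'. q = x # q' \<and> b = q' @ p) \<or> (\<exists>a'. a = q @ a' \<and> p = a' @ x # b)"
    using normal_form_exchange[OF Cons.prems(1) xv(1) ab(1,2)] by blast+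
  then consider (1) q' where "a = []" "q = x # q'" "b = q' @ p" | (2) a' where "a = q @ a'" "p = a' @ x # b"
    by blast
  then show ?case
  proof cases
    case 1
    then have "commutation\<^sup>*\<^sup>* v (q' @ p)"
      using Cons.IH[of q' p] normal_form_tl Cons.prems(1) rv vab by simp
    then show ?thesis
      using commutations_context[of v "q' @ p" "[x]" "[]"] 1 by simp
  next
    case 2
    have "commutation\<^sup>*\<^sup>* v (q @ a' @ b)"
      using Cons.IH[of q "a' @ b"] normal_form_remove Cons.prems(1) rv vab 2 by simp
    then have "commutation\<^sup>*\<^sup>* (x # v) (x # q @ a' @ b)"
      using commutations_context[of v "q @ a' @ b" "[x]" "[]"] by simp
    moreover have "\<forall>z\<in>set (q @ a'). m x z = 2"
      using normal_form_commute_prefix Cons.prems(1) 2 by simp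
    then have "commutation\<^sup>*\<^sup>* (x # (q @ a')) ((q @ a') @ [x])"
      using commutations_move[of x "q @ a'"] xv w 2 by simp
    then have "commutation\<^sup>*\<^sup>* (x # q @ a' @ b) (q @ p)"
      using commutations_context[of "x # q @ a'" "(q @ a') @ [x]" "[]" b] 2 by simp
    ultimately show ?thesis by simp
  qed
qed

lemma normal_form_in_Wc: "normal_form q p \<Longrightarrow> cls (q @ p) \<in> Wc"
  using mem_Wc_iff[OF normal_form_red] normal_form_unique commutations_sym by blast

lemma normal_form_left_descent:
  assumes f: "normal_form q p" and x: "x \<in> I" "x \<in> left_descents (cls (q @ p))"
  shows "(\<exists>q'. q = x # q' \<and> gen x \<otimes>\<^bsub>W\<^esub> cls (q @ p) = cls (q' @ p)) \<or>
    (\<exists>a b. p = a @ x # b \<and> gen x \<otimes>\<^bsub>W\<^esub> cls (q @ p) = cls (q @ a @ b))"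
proof -
  have w: "q @ p \<in> lists I" using normal_form_lists[OF f] by auto
  have r: "red (q @ p)" using normal_form_red f by simp
  then have "\<not> red (x # q @ p)" using left_descents_iff x by blast
  then obtain a y b where ab: "q @ p = a @ y # b" "a @ [y] \<approx> x # a" "x # q @ p \<approx> a @ b"
    using exchange[OF r x(1)] by blast
  have "gen x \<otimes>\<^bsub>W\<^esub> cls (q @ p) = cls (a @ b)"
    using gen_mult_cls[OF x(1) w] cls_eq[of "x # q @ p"] ab(3) x w by simp
  from normal_form_exchange[OF f x(1) ab(1,2)] show ?thesis
    using \<open>gen x \<otimes>\<^bsub>W\<^esub> cls (q @ p) = cls (a @ b)\<close> by fastforce
qed

text \<open>
  A pair \<open>x, y\<close> with \<open>m x y \<ge> 3\<close> that can be removed from the left in this order must be \<open>q\<close>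
  itself, because everything else commutes. The condition for \<open>q = [s, t]\<close> then says that
  multiplication by \<open>y\<close> stays fully commutative.
\<close>

lemma normal_form_not_left_reducible:
  assumes f: "normal_form q p" and q: "length q < 3"
    and f3: "\<And>s t. q = [s, t] \<Longrightarrow> normal_form [t, s, t] p"
    and xy: "x \<in> I" "y \<in> I"
  shows "\<not> left_weak_star_reducible x y (cls (q @ p))"
proof
  assume *: "left_weak_star_reducible x y (cls (q @ p))"
  then have m3: "3 \<le> m x y" and d: "x \<in> left_descents (cls (q @ p))"
    "y \<in> left_descents (gen x \<otimes>\<^bsub>W\<^esub> cls (q @ p))" and nW: "gen y \<otimes>\<^bsub>W\<^esub> cls (q @ p) \<notin> Wc"
    unfolding left_weak_star_reducible_def by auto
  have S: "x \<in> S" "y \<in> S" "m y x = m x y" using xy I_subset m_sym by auto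
  have w: "q @ p \<in> lists I" using normal_form_lists[OF f] by auto
  from normal_form_left_descent[OF f xy(1) d(1)] show False
  proof (elim disjE exE conjE)
    fix q' assume q': "q = x # q'" "gen x \<otimes>\<^bsub>W\<^esub> cls (q @ p) = cls (q' @ p)"
    have f': "normal_form q' p" using normal_form_tl f q' by simp
    have "y \<in> left_descents (cls (q' @ p))" using d(2) q'(2) by simp
    from normal_form_left_descent[OF f' xy(2) this] show False
    proof (elim disjE exE conjE)
      fix q'' assume "q' = y # q''"
      then have "q = [x, y]" using q q'(1) by (cases q'') auto
      then show False
        using f3 normal_form_in_Wc[of "[y, x, y]" p] nW gen_mult_cls[OF xy(2) w] by simp
    next
      fix a b assume "p = a @ y # b"
      then show False using normal_form_commute[OF f, of y x] q' m3 S by simp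
    qed
  next
    fix a b assume ab: "p = a @ x # b" "gen x \<otimes>\<^bsub>W\<^esub> cls (q @ p) = cls (q @ a @ b)"
    have f': "normal_form q (a @ b)" using normal_form_remove f ab by simp
    have "y \<in> left_descents (cls (q @ a @ b))" using d(2) ab(2) by simp
    from normal_form_left_descent[OF f' xy(2) this] show False
    proof (elim disjE exE conjE)
      fix q' assume "q = y # q'"
      then show False using normal_form_commute[OF f, of x y] ab m3 by simp
    next
      fix c d assume "a @ b = c @ y # d"
      then have "y \<in> set (a @ b)" by simp
      then have "y \<noteq> x" "y \<in> set p" "x \<in> set p" using f ab unfolding normal_form_def by auto
      then have "m x y = 2" using f unfolding normal_form_def by auto
      then show False using m3 by simp
    qed
  qed
qed

end

section \<open>Words on a path with one double edge\<close>

definition far :: "nat \<Rightarrow> nat \<Rightarrow> bool" where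
  "far i j \<longleftrightarrow> Suc i < j \<or> Suc j < i"

text \<open>
  The edges of the path that carry the exponent 3; the edge between 1 and 2 carries 4.
\<close>

definition simple_edge :: "nat \<Rightarrow> nat \<Rightarrow> bool" where
  "simple_edge i j \<longleftrightarrow> (j = Suc i \<or> i = Suc j) \<and> 2 \<le> i \<and> 2 \<le> j"

lemma far_sym: "far i j = far j i"
  by (auto simp: far_def)

lemma simple_edge_commute: "simple_edge i j = simple_edge j i"
  by (auto simp: simple_edge_def)

lemma not_distinct_first_repeat:
  assumes "\<not> distinct xs"
  shows "\<exists>a y b c. xs = a @ [y] @ b @ [y] @ c \<and> y \<notin> set b"
proof -
  obtain a y b c where "xs = a @ [y] @ b @ [y] @ c"
    using not_distinct_decomp[OF assms] by blast
  moreover obtain b' c' where "b @ [y] @ c = b' @ y # c'" "y \<notin> set b'"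
    using split_list_first[of y "b @ [y] @ c"] by auto
  ultimately show ?thesis by (metis append_Cons append_Nil)
qed

text \<open>
  The words of an irreducible fully commutative element of type \<open>B\<close>, described only through the
  commutations of distant letters and the factors, prefixes and suffixes that cannot occur.
\<close>

locale irreducible_fc =
  fixes X :: "nat list set"
  assumes pos: "u \<in> X \<Longrightarrow> i \<in> set u \<Longrightarrow> 1 \<le> i"
    and swap: "a @ [i, j] @ b \<in> X \<Longrightarrow> far i j \<Longrightarrow> a @ [j, i] @ b \<in> X"
    and no_square: "a @ [i, i] @ b \<notin> X"
    and no_braid3: "simple_edge i j \<Longrightarrow> a @ [i, j, i] @ b \<notin> X"
    and no_braid4: "a @ [1, 2, 1, 2] @ b \<notin> X" "a @ [2, 1, 2, 1] @ b \<notin> X"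
    and no_left3: "simple_edge i j \<Longrightarrow> [i, j] @ b \<notin> X"
    and no_left4: "[1, 2, 1] @ b \<notin> X" "[2, 1, 2] @ b \<notin> X"
    and no_right3: "simple_edge i j \<Longrightarrow> a @ [i, j] \<notin> X"
    and no_right4: "a @ [1, 2, 1] \<notin> X" "a @ [2, 1, 2] \<notin> X"
begin

text \<open>
  The conditions are symmetric, so every statement about the left end of words holds at the right
  end.
\<close>

lemma reversed: "irreducible_fc (rev ` X)"
proof -
  have *: "w \<in> rev ` X \<longleftrightarrow> rev w \<in> X" for w
    by (metis image_iff rev_rev_ident)
  show ?thesis
  proof
    fix u i assume "u \<in> rev ` X" "i \<in> set u"
    then show "1 \<le> i" using pos[of "rev u" i] unfolding * by simp
  next
    fix a i j b assume "a @ [i, j] @ b \<in> rev ` X" "far i j"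
    then show "a @ [j, i] @ b \<in> rev ` X"
      using swap[of "rev b" j i "rev a"] far_sym[of i j] unfolding * by simp
  next
    fix a i b show "a @ [i, i] @ b \<notin> rev ` X"
      using no_square[of "rev b" i "rev a"] unfolding * by simp
  next
    fix i j a b assume "simple_edge i j"
    then show "a @ [i, j, i] @ b \<notin> rev ` X"
      using no_braid3[of i j "rev b" "rev a"] unfolding * by simp
  next
    fix a b show "a @ [1, 2, 1, 2] @ b \<notin> rev ` X"
      using no_braid4(2)[of "rev b" "rev a"] unfolding * by simp
  next
    fix a b show "a @ [2, 1, 2, 1] @ b \<notin> rev ` X"
      using no_braid4(1)[of "rev b" "rev a"] unfolding * by simp
  next
    fix i j b assume "simple_edge i j"
    then show "[i, j] @ b \<notin> rev ` X"
      using no_right3[of j i "rev b"] unfolding * by (auto simp: simple_edge_def)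
  next
    fix b show "[1, 2, 1] @ b \<notin> rev ` X" using no_right4(1)[of "rev b"] unfolding * by simp
  next
    fix b show "[2, 1, 2] @ b \<notin> rev ` X" using no_right4(2)[of "rev b"] unfolding * by simp
  next
    fix i j a assume "simple_edge i j"
    then show "a @ [i, j] \<notin> rev ` X"
      using no_left3[of j i "rev a"] unfolding * by (auto simp: simple_edge_def)
  next
    fix a show "a @ [1, 2, 1] \<notin> rev ` X" using no_left4(1)[of "rev a"] unfolding * by simp
  next
    fix a show "a @ [2, 1, 2] \<notin> rev ` X" using no_left4(2)[of "rev a"] unfolding * by simp
  qed
qed

lemma move_left:
  "a @ b @ [x] @ c \<in> X \<Longrightarrow> \<forall>y\<in>set b. far x y \<Longrightarrow> a @ [x] @ b @ c \<in> X"
proof (induction b arbitrary: c rule: rev_induct)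
  case (snoc y b)
  have "(a @ b) @ [x, y] @ c \<in> X"
    using swap[of "a @ b" y x c] snoc.prems far_sym by simp
  then show ?case using snoc.IH[of "y # c"] snoc.prems by simp
qed simp

lemma move_right:
  "a @ [x] @ b @ c \<in> X \<Longrightarrow> \<forall>y\<in>set b. far x y \<Longrightarrow> a @ b @ [x] @ c \<in> X"
proof (induction b arbitrary: a)
  case (Cons y b)
  have "(a @ [y]) @ [x] @ b @ c \<in> X"
    using swap[of a x y "b @ c"] Cons.prems by simp
  then show ?case using Cons.IH[of "a @ [y]"] Cons.prems by simp
qed simp

lemma repeat_has_neighbour:
  assumes "a @ [i] @ b @ [i] @ c \<in> X"
  shows "\<exists>y\<in>set b. \<not> far i y"
proof (rule ccontr)
  assume "\<not> ?thesis"
  then have "a @ [i, i] @ b @ c \<in> X"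
    using move_left[of "a @ [i]" b i c] assms by auto
  then show False using no_square by blast
qed

lemma repeat_not_single_neighbour:
  assumes u: "a @ [i] @ b @ [j] @ c @ [i] @ d \<in> X" and e: "simple_edge i j"
  shows "\<exists>y\<in>set (b @ c). \<not> far i y"
proof (rule ccontr)
  assume n: "\<not> ?thesis"
  then have "a @ b @ [i] @ [j] @ c @ [i] @ d \<in> X"
    using move_right[of a i b "[j] @ c @ [i] @ d"] u by auto
  then have "(a @ b @ [i, j]) @ [i] @ c @ d \<in> X"
    using move_left[of "a @ b @ [i, j]" c i d] n by auto
  then show False using no_braid3[OF e, of "a @ b" "c @ d"] by simp
qed

text \<open>
  One lower neighbour alone would give the factor \<open>i (i - 1) i\<close>.
\<close>

lemma repeat_two_below:
  assumes u: "a @ [i] @ b @ [i] @ c \<in> X" and b: "i \<notin> set b" "Suc i \<notin> set b" and i: "3 \<le> i"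
  shows "\<exists>b1 b2 b3. b = b1 @ [i - 1] @ b2 @ [i - 1] @ b3 \<and> i - 1 \<notin> set b1 \<and> i - 1 \<notin> set b2"
proof -
  have nb: "y = i - 1 \<or> far i y" if "y \<in> set b" for y
  proof -
    have "y \<noteq> i" "y \<noteq> Suc i" using that b by auto
    then show ?thesis unfolding far_def by linarith
  qed
  then have "i - 1 \<in> set b" using repeat_has_neighbour[OF u] by auto
  then obtain b1 r where r: "b = b1 @ (i - 1) # r" "i - 1 \<notin> set b1" by (meson split_list_first)
  have e: "simple_edge i (i - 1)" using i unfolding simple_edge_def by auto
  have "\<exists>y\<in>set (b1 @ r). \<not> far i y"
    using repeat_not_single_neighbour[of a i b1 "i - 1" r c] e u r by simp
  then have "i - 1 \<in> set r" using nb r by auto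
  then obtain b2 b3 where "r = b2 @ (i - 1) # b3" "i - 1 \<notin> set b2" by (meson split_list_first)
  then show ?thesis using r by auto
qed

lemma repeat_one_needs_two:
  assumes "a @ [1] @ b @ [1] @ c \<in> X"
  shows "1 \<in> set b \<or> 2 \<in> set b"
proof -
  obtain y where y: "y \<in> set b" "\<not> far 1 y" using repeat_has_neighbour[OF assms] by blast
  moreover have "1 \<le> y" using pos[OF assms, of y] y by simp
  ultimately show ?thesis unfolding far_def by (cases "y = 1"; cases "y = 2") auto
qed

text \<open>
  At the lower end the double edge allows \<open>2 1 2\<close>, and two letters 1 would need another 2 between
  them.
\<close>

lemma repeat_two_single_one:
  assumes u: "a @ [2] @ b @ [2] @ c \<in> X" and b: "2 \<notin> set b" "3 \<notin> set b"
  shows "\<exists>b1 b2. b = b1 @ [1] @ b2 \<and> (\<forall>y\<in>set (b1 @ b2). 4 \<le> y)"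
proof -
  have big: "y = 1 \<or> 4 \<le> y" if "y \<in> set b" for y
  proof -
    have "1 \<le> y" using pos[OF u, of y] that by simp
    moreover have "y \<noteq> 2" "y \<noteq> 3" using that b by auto
    ultimately show ?thesis by linarith
  qed
  then have "1 \<in> set b" using repeat_has_neighbour[OF u] unfolding far_def by fastforce
  then obtain b1 b2 where r: "b = b1 @ 1 # b2" "1 \<notin> set b1" by (meson split_list_first)
  have "1 \<notin> set b2"
  proof
    assume "1 \<in> set b2"
    then obtain b3 b4 where s: "b2 = b3 @ 1 # b4" "1 \<notin> set b3" by (meson split_list_first)
    then have "(a @ [2] @ b1) @ [1] @ b3 @ [1] @ (b4 @ [2] @ c) \<in> X" using u r by simp
    then show False using repeat_one_needs_two s r b by fastforce
  qed
  have "4 \<le> y" if y: "y \<in> set (b1 @ b2)" for y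
  proof -
    have "y \<noteq> 1" using y r(2) \<open>1 \<notin> set b2\<close> by auto
    moreover have "y \<in> set b" using y r(1) by auto
    ultimately show ?thesis using big by blast
  qed
  then show ?thesis using r(1) by (intro exI[of _ b1] exI[of _ b2]) simp
qed

lemma prefix_contradiction:
  assumes u: "a @ [i] @ b @ [j] @ c \<in> X" and e: "simple_edge i j"
    and a: "\<forall>y\<in>set a. far i y \<and> far j y" and b: "\<forall>y\<in>set b. far j y"
  shows False
proof -
  have "[] @ [i] @ a @ (b @ [j] @ c) \<in> X" using move_left[of "[]" a i] u a by simp
  then have "[i] @ [j] @ (a @ b) @ c \<in> X" using move_left[of "[i]" "a @ b" j c] a b by auto
  then show False using no_left3[OF e] by simp
qed

text \<open>
  The configuration propagates down the path. The two letters \<open>i\<close> without \<open>i + 1\<close> between them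
  enclose two letters \<open>i - 1\<close>; the first of these and the preceding \<open>i - 1\<close> enclose a single \<open>i\<close>
  and hence some \<open>i - 2\<close>. This is the same configuration for \<open>i - 1\<close>. At \<open>i = 2\<close> it yields the
  factor \<open>1 2 1 2\<close>.
\<close>

lemma repeat_above_after_below:
  assumes "a @ [i - 1] @ d @ [i] @ b @ [i] @ c \<in> X" "2 \<le> i"
    and "i \<notin> set d" "i \<notin> set b" "Suc i \<notin> set b"
  shows False
  using assms
proof (induction i arbitrary: a b c d rule: less_induct)
  case (less i)
  (* Without loss of generality the i - 1 in front of the first i is the last one there. *)
  obtain d0 d2 where d2: "[i - 1] @ d = d0 @ (i - 1) # d2" "i - 1 \<notin> set d2"
    using split_list_last[of "i - 1" "[i - 1] @ d"] by auto
  define a' where "a' = a @ d0"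
  have id2: "i \<notin> set d2"
  proof -
    have "set d2 \<subseteq> set d" using d2(1) by (cases d0) auto
    then show ?thesis using less.prems by auto
  qed
  have u: "a' @ [i - 1] @ d2 @ [i] @ b @ [i] @ c \<in> X"
  proof -
    have "a @ ([i - 1] @ d) @ [i] @ b @ [i] @ c \<in> X" using less.prems(1) by simp
    then have "a @ (d0 @ (i - 1) # d2) @ [i] @ b @ [i] @ c \<in> X" by (simp only: d2(1))
    then show ?thesis by (simp add: a'_def)
  qed
  show False
  proof (cases "i = 2")
    case True
    have "(a' @ [1] @ d2) @ [2] @ b @ [2] @ c \<in> X" using u True by simp
    then obtain b1 b2 where b: "b = b1 @ [1] @ b2" "\<forall>y\<in>set (b1 @ b2). 4 \<le> y"
      using repeat_two_single_one less.prems True by (metis One_nat_def Suc_1 numeral_3_eq_3)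
    have fd: "\<forall>y\<in>set d2. far 1 y"
    proof
      fix y assume y: "y \<in> set d2"
      then have "1 \<le> y" using pos[OF u] by simp
      moreover have "y \<noteq> 1" "y \<noteq> 2" using y id2 d2 True by auto
      ultimately show "far 1 y" unfolding far_def by simp
    qed
    have fb: "far 1 y \<and> far 2 y" if "y \<in> set b1 \<union> set b2" for y
    proof -
      have "4 \<le> y" using b(2) that by auto
      then show ?thesis unfolding far_def by linarith
    qed
    have "a' @ d2 @ [1] @ [2] @ b1 @ [1] @ b2 @ [2] @ c \<in> X"
      using move_right[of a' 1 d2 "[2] @ b1 @ [1] @ b2 @ [2] @ c"] u True b fd by simp
    then have "(a' @ d2 @ [1, 2]) @ [1] @ b1 @ (b2 @ [2] @ c) \<in> X"
      using move_left[of "a' @ d2 @ [1, 2]" b1 1 "b2 @ [2] @ c"] fb by simp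
    then have "(a' @ d2 @ [1, 2, 1]) @ [2] @ (b1 @ b2) @ c \<in> X"
      using move_left[of "a' @ d2 @ [1, 2, 1]" "b1 @ b2" 2 c] fb by simp
    then show False using no_braid4(1)[of "a' @ d2" "b1 @ b2 @ c"] by simp
  next
    case False
    then have i: "3 \<le> i" using less.prems(2) by simp
    have "(a' @ [i - 1] @ d2) @ [i] @ b @ [i] @ c \<in> X" using u by simp
    then obtain b1 b2 b3 where b: "b = b1 @ [i - 1] @ b2 @ [i - 1] @ b3"
      "i - 1 \<notin> set b1" "i - 1 \<notin> set b2"
      using repeat_two_below less.prems i by blast
    have u': "a' @ [i - 1] @ d2 @ [i] @ b1 @ [i - 1] @ (b2 @ [i - 1] @ b3 @ [i] @ c) \<in> X"
      using u b by simp
    moreover have "simple_edge (i - 1) i" using i unfolding simple_edge_def by auto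
    ultimately obtain y where y: "y \<in> set (d2 @ b1)" "\<not> far (i - 1) y"
      using repeat_not_single_neighbour by blast
    have "y \<noteq> i - 1" "y \<noteq> i" using y b d2 id2 less.prems by auto
    then have "y = i - 2" using y(2) i unfolding far_def by linarith
    then have "i - 2 \<in> set (d2 @ [i] @ b1)" using y by auto
    then obtain x z where xz: "d2 @ [i] @ b1 = x @ (i - 2) # z" by (meson split_list)
    have "i - 1 \<notin> set (d2 @ [i] @ b1)" using b d2 i by auto
    then have z: "i - 1 \<notin> set z" unfolding xz by auto
    have eq: "a' @ [i - 1] @ (d2 @ [i] @ b1) @ [i - 1] @ b2 @ [i - 1] @ b3 @ [i] @ c
      = (a' @ [i - 1] @ x) @ [(i - 1) - 1] @ z @ [i - 1] @ b2 @ [i - 1] @ (b3 @ [i] @ c)"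
      unfolding xz using i by (simp add: numeral_2_eq_2)
    have "Suc (i - 1) \<notin> set b2" using less.prems b i by simp
    moreover have "(a' @ [i - 1] @ x) @ [(i - 1) - 1] @ z @ [i - 1] @ b2 @ [i - 1] @ (b3 @ [i] @ c) \<in> X"
      unfolding eq[symmetric] using u' by simp
    moreover have "i - 1 < i" "2 \<le> i - 1" using i by linarith+
    ultimately show False
      using less.IH[of "i - 1"] z b(3) by blast
  qed
qed

text \<open>
  The first of the two letters \<open>i\<close> can be moved to the front. Since the first \<open>i - 1\<close> after it must
  not follow it directly, some \<open>i - 2\<close> precedes that \<open>i - 1\<close>, which leads to the configuration of
  \<open>repeat_above_after_below\<close>. For \<open>i = 2\<close> the prefix \<open>2 1 2\<close> results.
\<close>

lemma initial_repeat:
  assumes u: "a @ [i] @ b @ [i] @ c \<in> X" and i: "2 \<le> i"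
    and b: "i \<notin> set b" "Suc i \<notin> set b"
    and a: "i - 1 \<notin> set a" "i \<notin> set a" "Suc i \<notin> set a"
  shows False
proof (cases "i = 2")
  case True
  then obtain b1 b2 where b12: "b = b1 @ [1] @ b2" "\<forall>y\<in>set (b1 @ b2). 4 \<le> y"
    using repeat_two_single_one[of a b c] u b by auto
  have fa: "far 1 y \<and> far 2 y" if y: "y \<in> set a" for y
  proof -
    have "1 \<le> y" using pos[OF u] y by simp
    moreover have "y \<noteq> 1" "y \<noteq> 2" "y \<noteq> 3" using y a True by auto
    ultimately show ?thesis unfolding far_def by linarith
  qed
  have fb: "far 1 y \<and> far 2 y" if "y \<in> set b1 \<union> set b2" for y
  proof -
    have "4 \<le> y" using b12(2) that by auto
    then show ?thesis unfolding far_def by linarith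
  qed
  have "[] @ [2] @ a @ (b1 @ [1] @ b2 @ [2] @ c) \<in> X"
    using move_left[of "[]" a 2] u fa b12 True by simp
  then have "[2] @ [1] @ (a @ b1) @ (b2 @ [2] @ c) \<in> X"
    using move_left[of "[2]" "a @ b1" 1 "b2 @ [2] @ c"] fa fb by auto
  then have "[2, 1] @ [2] @ (a @ b1 @ b2) @ c \<in> X"
    using move_left[of "[2, 1]" "a @ b1 @ b2" 2 c] fa fb by auto
  then show False using no_left4(2) by simp
next
  case False
  then have i3: "3 \<le> i" using i by simp
  then obtain b1 b2 b3 where b12: "b = b1 @ [i - 1] @ b2 @ [i - 1] @ b3"
    "i - 1 \<notin> set b1" "i - 1 \<notin> set b2"
    using repeat_two_below[OF u b] by blast
  have n: "i - 1 \<notin> set (a @ [i] @ b1)" using a b12 i by auto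
  show False
  proof (cases "i - 2 \<in> set (a @ [i] @ b1)")
    case True
    then obtain x z where xz: "a @ [i] @ b1 = x @ (i - 2) # z" by (meson split_list)
    have z: "i - 1 \<notin> set z" using n unfolding xz by auto
    have "(a @ [i] @ b1) @ [i - 1] @ b2 @ [i - 1] @ b3 @ [i] @ c \<in> X" using u b12 by simp
    then have "x @ [(i - 1) - 1] @ z @ [i - 1] @ b2 @ [i - 1] @ (b3 @ [i] @ c) \<in> X"
      unfolding xz using i3 by (simp add: numeral_2_eq_2)
    moreover have "Suc (i - 1) \<notin> set b2" using b b12 i by simp
    moreover have "2 \<le> i - 1" using i3 by linarith
    ultimately show False
      using repeat_above_after_below z b12(3) by blast
  next
    case False
    have fa: "far i y \<and> far (i - 1) y" if y: "y \<in> set a" for y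
    proof -
      have "y \<noteq> i - 1" "y \<noteq> i" "y \<noteq> Suc i" "y \<noteq> i - 2" using y a False by auto
      then show ?thesis using i3 unfolding far_def by linarith
    qed
    have fb: "far (i - 1) y" if y: "y \<in> set b1" for y
    proof -
      have "y \<noteq> i - 1" "y \<noteq> i" "y \<noteq> i - 2" using y b b12 False by auto
      then show ?thesis using i3 unfolding far_def by linarith
    qed
    have "simple_edge i (i - 1)" using i3 unfolding simple_edge_def by auto
    moreover have "a @ [i] @ b1 @ [i - 1] @ (b2 @ [i - 1] @ b3 @ [i] @ c) \<in> X" using u b12 by simp
    ultimately show False using prefix_contradiction fa fb by blast
  qed
qed

text \<open>
  Without such a \<open>k - 1\<close>, the earlier one of the first \<open>k\<close> and the first \<open>k + 1\<close> can be moved to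
  the front and the other one right behind it, giving a forbidden prefix, or \<open>k\<close> is repeated before the
  first \<open>k + 1\<close> as in \<open>initial_repeat\<close>. Here \<open>k\<close> is the only neighbour of \<open>k + 1\<close> in the word.
\<close>

lemma below_before_first:
  assumes u: "a @ [k] @ b \<in> X" and k: "2 \<le> k" "k \<notin> set a"
    and K: "Suc k \<in> set (a @ b)" "Suc (Suc k) \<notin> set (a @ b)"
  shows "k - 1 \<in> set a"
proof (rule ccontr)
  assume n: "k - 1 \<notin> set a"
  have e: "simple_edge (Suc k) k" "simple_edge k (Suc k)" using k unfolding simple_edge_def by auto
  show False
  proof (cases "Suc k \<in> set a")
    case True
    then obtain a1 a2 where a: "a = a1 @ Suc k # a2" "Suc k \<notin> set a1" by (meson split_list_first)
    have "Suc k \<notin> set a2"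
    proof
      assume "Suc k \<in> set a2"
      then obtain a3 a4 where a2: "a2 = a3 @ Suc k # a4" "Suc k \<notin> set a3" by (meson split_list_first)
      have "a1 @ [Suc k] @ a3 @ [Suc k] @ (a4 @ [k] @ b) \<in> X" using u a a2 by simp
      then obtain y where y: "y \<in> set a3" "\<not> far (Suc k) y" using repeat_has_neighbour by blast
      have "y \<noteq> k" "y \<noteq> Suc k" "y \<noteq> Suc (Suc k)" using y a a2 k K by auto
      then show False using y(2) unfolding far_def by linarith
    qed
    then have "far (Suc k) y \<and> far k y" if y: "y \<in> set a1 \<union> set a2" for y
    proof -
      have "y \<noteq> k" "y \<noteq> k - 1" "y \<noteq> Suc k" "y \<noteq> Suc (Suc k)"
        using y a k K n \<open>Suc k \<notin> set a2\<close> by auto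
      then show ?thesis unfolding far_def by linarith
    qed
    then show False using prefix_contradiction[of a1 "Suc k" a2 k b] u a e by simp
  next
    case False
    then have "Suc k \<in> set b" using K by auto
    then obtain b1 b2 where b: "b = b1 @ Suc k # b2" "Suc k \<notin> set b1" by (meson split_list_first)
    show False
    proof (cases "k \<in> set b1")
      case True
      then obtain b3 b4 where b1: "b1 = b3 @ k # b4" "k \<notin> set b3" by (meson split_list_first)
      have "a @ [k] @ b3 @ [k] @ (b4 @ [Suc k] @ b2) \<in> X" using u b b1 by simp
      then show False using initial_repeat k b b1 n False by fastforce
    next
      case kb: False
      have fa: "far k y \<and> far (Suc k) y" if y: "y \<in> set a" for y
      proof -
        have "y \<noteq> k" "y \<noteq> k - 1" "y \<noteq> Suc k" "y \<noteq> Suc (Suc k)" using y k K n False by auto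
        then show ?thesis unfolding far_def by linarith
      qed
      have fb: "far (Suc k) y" if y: "y \<in> set b1" for y
      proof -
        have "y \<noteq> k" "y \<noteq> Suc k" "y \<noteq> Suc (Suc k)" using y b K kb by auto
        then show ?thesis unfolding far_def by linarith
      qed
      show False using prefix_contradiction[of a k b1 "Suc k" b2] u b e fa fb by simp
    qed
  qed
qed

lemma below_after_last:
  assumes u: "a @ [k] @ b \<in> X" and k: "2 \<le> k" "k \<notin> set b"
    and K: "Suc k \<in> set (a @ b)" "Suc (Suc k) \<notin> set (a @ b)"
  shows "k - 1 \<in> set b"
proof -
  interpret r: irreducible_fc "rev ` X" by (rule reversed)
  have "rev b @ [k] @ rev a \<in> rev ` X"
    using imageI[OF u, of rev] by simp
  then show ?thesis using r.below_before_first[of "rev b" k "rev a"] k K by auto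
qed

text \<open>
  If \<open>k\<close> occurs before \<open>k + 1\<close>, the first occurrences of all smaller letters are in increasing
  order too: if the first \<open>i\<close> could be moved to the front, then \<open>i\<close> and \<open>i + 1\<close> would form a
  forbidden prefix, or \<open>i\<close> would be repeated as in \<open>initial_repeat\<close>.
\<close>

lemma increasing_first_occurrences:
  assumes u: "u \<in> X" and k: "u = a0 @ [k] @ b0" "k \<notin> set a0" "k - 1 \<in> set a0" "Suc k \<notin> set a0"
    and i: "2 \<le> i" "i \<le> k"
  shows "\<exists>a b. u = a @ [i] @ b \<and> i \<notin> set a \<and> Suc i \<notin> set a \<and> i - 1 \<in> set a"
  using i(2,1)
proof (induction i rule: inc_induct)
  case base
  then show ?case using k by blast
next
  case (step i)
  then obtain a b where ab: "u = a @ [Suc i] @ b" "Suc i \<notin> set a" "Suc (Suc i) \<notin> set a" "i \<in> set a"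
    by auto
  obtain a1 a2 where a: "a = a1 @ i # a2" "i \<notin> set a1" using ab(4) by (meson split_list_first)
  have "i - 1 \<in> set a1"
  proof (rule ccontr)
    assume n: "i - 1 \<notin> set a1"
    show False
    proof (cases "i \<in> set a2")
      case True
      then obtain a3 a4 where a2: "a2 = a3 @ i # a4" "i \<notin> set a3" by (meson split_list_first)
      have "a1 @ [i] @ a3 @ [i] @ (a4 @ [Suc i] @ b) \<in> X" using u ab a a2 by simp
      then show False using initial_repeat[of a1 i a3] step.prems a a2 ab n by simp
    next
      case False
      have f1: "far i y \<and> far (Suc i) y" if y: "y \<in> set a1" for y
      proof -
        have "y \<noteq> i" "y \<noteq> i - 1" "y \<noteq> Suc i" "y \<noteq> Suc (Suc i)" using y a ab n by auto
        then show ?thesis unfolding far_def by linarith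
      qed
      have f2: "far (Suc i) y" if y: "y \<in> set a2" for y
      proof -
        have "y \<noteq> i" "y \<noteq> Suc i" "y \<noteq> Suc (Suc i)" using y a ab False by auto
        then show ?thesis unfolding far_def by linarith
      qed
      have "simple_edge i (Suc i)" using step.prems unfolding simple_edge_def by auto
      moreover have "a1 @ [i] @ a2 @ [Suc i] @ b \<in> X" using u ab a by simp
      ultimately show False using prefix_contradiction f1 f2 by blast
    qed
  qed
  moreover have "u = a1 @ [i] @ (a2 @ [Suc i] @ b)" using ab a by simp
  moreover have "i \<notin> set a1" "Suc i \<notin> set a1" using ab a by auto
  ultimately show ?case by blast
qed

lemma first_occurrence_unique:
  assumes "a @ [i] @ b = a' @ [i] @ b'" "i \<notin> set a" "i \<notin> set a'"
  shows "a = a' \<and> b = b'"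
proof -
  have *: "takeWhile (\<lambda>x. x \<noteq> i) (c @ [i] @ d) = c" if "i \<notin> set c" for c d
    using that by (induction c) auto
  have "a = a'" using *[OF assms(2), of b] *[OF assms(3), of b'] assms(1) by simp
  then show ?thesis using assms(1) by simp
qed

text \<open>
  The first two letters \<open>k - 1\<close> enclose a single \<open>k\<close>, so they also enclose a \<open>k - 2\<close>; since a
  \<open>k - 2\<close> precedes them, the first two letters \<open>k - 2\<close> enclose a single \<open>k - 1\<close>. Continuing down the
  path, the first two letters 1 enclose a single 2, and all three move to the front.
\<close>

lemma increasing_contradiction:
  assumes u: "u \<in> X" and k: "u = a0 @ [k] @ b0" "k \<notin> set a0" "Suc k \<notin> set a0" "2 \<le> k"
    and K: "Suc k \<in> set u" "Suc (Suc k) \<notin> set u"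
  shows False
proof -
  have uk: "a0 @ [k] @ b0 \<in> X" using u k by simp
  have k1: "k - 1 \<in> set a0" using below_before_first[OF uk] k K by auto
  (* Valid for every first occurrence of i, since the decomposition at a first occurrence is unique. *)
  have M: "i \<notin> set a \<Longrightarrow> u = a @ [i] @ b \<Longrightarrow> Suc i \<notin> set a \<and> i - 1 \<in> set a"
    if "2 \<le> i" "i \<le> k" for i a b
    using increasing_first_occurrences[OF u k(1,2) k1 k(3) that] first_occurrence_unique
    by (metis (no_types, lifting))
  (* A repetition of i here would come after an i - 1 and have no i + 1 inside. *)
  have single: "i \<notin> set d" if e: "u = a @ [i] @ d @ [Suc i] @ e" and ai: "i \<notin> set a"
    "Suc i \<notin> set a" "Suc i \<notin> set d" and i: "1 \<le> i" "i < k" for a i d e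
  proof
    assume "i \<in> set d"
    then obtain d1 d2 where d: "d = d1 @ i # d2" "i \<notin> set d1" by (meson split_list_first)
    have u2: "a @ [i] @ d1 @ [i] @ (d2 @ [Suc i] @ e) \<in> X" using u e d by simp
    show False
    proof (cases "i = 1")
      case True
      then have "1 \<in> set d1 \<or> 2 \<in> set d1"
        using repeat_one_needs_two[of a d1 "d2 @ [Suc i] @ e"] u2 by simp
      then show False using d ai True by (auto simp: numeral_2_eq_2)
    next
      case False
      then have "i - 1 \<in> set a" using M[of i a "d @ [Suc i] @ e"] e ai i by simp
      then obtain x z where xz: "a = x @ (i - 1) # z" by (meson split_list)
      then show False
        using repeat_above_after_below[of x i z d1 "d2 @ [Suc i] @ e"] u2 d ai i False by simp
    qed
  qed
  (* The displayed letters are the first two i and the first i + 1 of the word, because neither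
     letter occurs in a. *)
  have D: "\<exists>a b1 b2 c. u = a @ [i] @ b1 @ [Suc i] @ b2 @ [i] @ c \<and>
      {i, Suc i} \<inter> (set a \<union> set b1 \<union> set b2) = {}" if "i \<le> k - 1" "1 \<le> i" for i
    using that
  proof (induction i rule: inc_induct)
    case base
    have kk: "Suc (k - 1) = k" using k by simp
    obtain a1 a2 where a: "a0 = a1 @ (k - 1) # a2" "k - 1 \<notin> set a1"
      using k1 by (meson split_list_first)
    have a2: "k - 1 \<notin> set a2"
      using single[of a1 "k - 1" a2 b0] k a base kk by auto
    have "k - 1 \<in> set b0"
    proof -
      obtain x z where xz: "[k] @ b0 = x @ k # z" "k \<notin> set z"
        using split_list_last[of k "[k] @ b0"] by auto
      then have ux: "(a0 @ x) @ [k] @ z \<in> X" using uk by simp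
      then have "k - 1 \<in> set z" using below_after_last[OF ux] k xz K by fastforce
      moreover have "set z \<subseteq> set b0" using xz by (cases x) auto
      ultimately show ?thesis by auto
    qed
    then obtain b1 b2 where b: "b0 = b1 @ (k - 1) # b2" "k - 1 \<notin> set b1" by (meson split_list_first)
    have "k \<notin> set b1"
    proof
      assume "k \<in> set b1"
      then obtain b3 b4 where b3: "b1 = b3 @ k # b4" "k \<notin> set b3" by (meson split_list_first)
      have u3: "a0 @ [k] @ b3 @ [k] @ (b4 @ [k - 1] @ b2) \<in> X" using uk b b3 by simp
      have nb: "y = Suc k \<or> far k y" if y: "y \<in> set b3" for y
      proof -
        have "y \<noteq> k" "y \<noteq> k - 1" using y b b3 by auto
        then show ?thesis unfolding far_def by linarith
      qed
      then have "Suc k \<in> set b3" using repeat_has_neighbour[OF u3] by auto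
      then obtain b5 b6 where b5: "b3 = b5 @ Suc k # b6" "Suc k \<notin> set b5" by (meson split_list_first)
      have "simple_edge k (Suc k)" using k unfolding simple_edge_def by auto
      then have "\<exists>y\<in>set (b5 @ b6). \<not> far k y"
        using repeat_not_single_neighbour[of a0 k b5 "Suc k" b6 "b4 @ [k - 1] @ b2"] u3 b5 by simp
      then have "Suc k \<in> set b6" using nb b5 by auto
      then obtain b7 b8 where b7: "b6 = b7 @ Suc k # b8" "Suc k \<notin> set b7" by (meson split_list_first)
      have "(a0 @ [k] @ b5) @ [Suc k] @ b7 @ [Suc k] @ (b8 @ [k] @ b4 @ [k - 1] @ b2) \<in> X"
        using u3 b5 b7 by simp
      then obtain y where y: "y \<in> set b7" "\<not> far (Suc k) y" using repeat_has_neighbour by blast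
      have "y \<noteq> k" "y \<noteq> Suc k" "y \<noteq> Suc (Suc k)" using y b b3 b5 b7 k K by auto
      then show False using y(2) unfolding far_def by linarith
    qed
    moreover have "u = a1 @ [k - 1] @ a2 @ [k] @ b1 @ [k - 1] @ b2" using k a b by simp
    ultimately show ?case using a a2 b k kk
      by (intro exI[of _ a1] exI[of _ a2] exI[of _ b1] exI[of _ b2]) auto
  next
    case (step i)
    then obtain a b1 b2 c where u1: "u = a @ [Suc i] @ b1 @ [Suc (Suc i)] @ b2 @ [Suc i] @ c"
      and n: "{Suc i, Suc (Suc i)} \<inter> (set a \<union> set b1 \<union> set b2) = {}" by auto
    have i: "1 \<le> i" "Suc i \<le> k" "Suc i < k" using step by auto
    have "simple_edge (Suc i) (Suc (Suc i))" using i unfolding simple_edge_def by auto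
    then obtain y where y: "y \<in> set (b1 @ b2)" "\<not> far (Suc i) y"
      using repeat_not_single_neighbour u u1 by blast
    have "y \<noteq> Suc i" "y \<noteq> Suc (Suc i)" using y n by auto
    then have "y = i" using y(2) unfolding far_def by linarith
    then have "i \<in> set (b1 @ [Suc (Suc i)] @ b2)" using y by auto
    then obtain r1 r2 where r: "b1 @ [Suc (Suc i)] @ b2 = r1 @ i # r2" "i \<notin> set r1"
      by (meson split_list_first)
    have "set r1 \<subseteq> set (b1 @ [Suc (Suc i)] @ b2)" unfolding r(1) by auto
    then have r1: "Suc i \<notin> set r1" using n by auto
    have "i \<in> set a" using M[of "Suc i" a] u1 n i by auto
    then obtain a1 a2 where a: "a = a1 @ i # a2" "i \<notin> set a1" by (meson split_list_first)
    have "i \<notin> set a2"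
      using single[of a1 i a2] u1 a n i by auto
    moreover have "u = a1 @ [i] @ a2 @ [Suc i] @ r1 @ [i] @ (r2 @ [Suc i] @ c)"
    proof -
      have "u = a1 @ [i] @ a2 @ [Suc i] @ (b1 @ [Suc (Suc i)] @ b2) @ [Suc i] @ c"
        using u1 a by simp
      then show ?thesis unfolding r(1) by simp
    qed
    moreover have "Suc i \<notin> set a1" "Suc i \<notin> set a2" using a n by auto
    ultimately show ?case using a r r1
      by (intro exI[of _ a1] exI[of _ a2] exI[of _ r1] exI[of _ "r2 @ [Suc i] @ c"]) auto
  qed
  have "1 \<le> k - 1" using k(4) by linarith
  from D[OF this order_refl] obtain a b1 b2 c where u1: "u = a @ [1] @ b1 @ [2] @ b2 @ [1] @ c"
    and n: "{1, 2} \<inter> (set a \<union> set b1 \<union> set b2) = {}"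
    unfolding Suc_1 by blast
  have "3 \<notin> set (a @ [1] @ b1)"
    using M[of 2 "a @ [1] @ b1" "b2 @ [1] @ c"] u1 n k by (auto simp: numeral_3_eq_3)
  then have f2: "far 1 y \<and> far 2 y" if y: "y \<in> set a \<union> set b1" for y
  proof -
    have "1 \<le> y" using pos[OF u, of y] u1 y by auto
    moreover have "y \<noteq> 1" "y \<noteq> 2" "y \<noteq> 3" using y n \<open>3 \<notin> set (a @ [1] @ b1)\<close> by auto
    ultimately show ?thesis unfolding far_def by linarith
  qed
  have f1: "far 1 y" if y: "y \<in> set b2" for y
  proof -
    have "1 \<le> y" using pos[OF u, of y] u1 y by auto
    moreover have "y \<noteq> 1" "y \<noteq> 2" using y n by auto
    ultimately show ?thesis unfolding far_def by linarith
  qed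
  have "[] @ [1] @ a @ (b1 @ [2] @ b2 @ [1] @ c) \<in> X"
    using move_left[of "[]" a 1] u u1 f2 by simp
  then have "[1] @ [2] @ (a @ b1) @ (b2 @ [1] @ c) \<in> X"
    using move_left[of "[1]" "a @ b1" 2 "b2 @ [1] @ c"] f2 by auto
  then have "[1, 2] @ [1] @ (a @ b1 @ b2) @ c \<in> X"
    using move_left[of "[1, 2]" "a @ b1 @ b2" 1 c] f1 f2 by auto
  then show False using no_left4(1) by simp
qed

text \<open>
  By \<open>increasing_contradiction\<close> and its mirror image, letters \<open>k + 1\<close> occur both before the first
  and after the last \<open>k\<close>. Two consecutive ones enclose two letters \<open>k\<close>, and the first \<open>k\<close> is
  preceded by \<open>k - 1\<close>, which is the configuration excluded by \<open>repeat_above_after_below\<close>.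
\<close>

lemma no_high_edge:
  assumes u: "u \<in> X" and k: "2 \<le> k" "k \<in> set u" and K: "Suc k \<in> set u" "Suc (Suc k) \<notin> set u"
  shows False
proof -
  obtain a b where ab: "u = a @ k # b" "k \<notin> set a" using k by (meson split_list_first)
  obtain a' b' where ab': "u = a' @ k # b'" "k \<notin> set b'" using k by (meson split_list_last)
  have left: "Suc k \<in> set a"
    using increasing_contradiction[OF u, of a k b] ab k K by auto
  have right: "Suc k \<in> set b'"
  proof (rule ccontr)
    interpret r: irreducible_fc "rev ` X" by (rule reversed)
    assume "Suc k \<notin> set b'"
    moreover have "rev u \<in> rev ` X" using u by simp
    ultimately show False
      using r.increasing_contradiction[of "rev u" "rev b'" k "rev a'"] ab' k K by simp
  qed
  have uX: "a @ [k] @ b \<in> X" using u ab by simp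
  have "length a \<le> length a'"
  proof (rule ccontr)
    assume "\<not> ?thesis"
    then have "k \<in> set a"
      using ab ab' by (auto simp: append_eq_append_conv2 append_eq_Cons_conv Cons_eq_append_conv)
    then show False using ab by simp
  qed
  then have "Suc k \<in> set b"
    using ab ab' right by (auto simp: append_eq_append_conv2 append_eq_Cons_conv Cons_eq_append_conv)
  then obtain b1 b2 where b: "b = b1 @ Suc k # b2" "Suc k \<notin> set b1" by (meson split_list_first)
  obtain a1 a2 where a: "a = a1 @ Suc k # a2" "Suc k \<notin> set a2" using left by (meson split_list_last)
  have "k \<in> set b1"
  proof (rule ccontr)
    assume "k \<notin> set b1"
    have "simple_edge (Suc k) k" using k unfolding simple_edge_def by auto
    moreover have "a1 @ [Suc k] @ a2 @ [k] @ b1 @ [Suc k] @ b2 \<in> X" using uX a b by simp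
    ultimately obtain y where y: "y \<in> set (a2 @ b1)" "\<not> far (Suc k) y"
      using repeat_not_single_neighbour by blast
    have "y \<noteq> k" "y \<noteq> Suc k" "y \<noteq> Suc (Suc k)"
      using y a b ab K \<open>k \<notin> set b1\<close> by auto
    then show False using y(2) unfolding far_def by linarith
  qed
  then obtain b3 b4 where b3: "b1 = b3 @ k # b4" "k \<notin> set b3" by (meson split_list_first)
  have "k - 1 \<in> set a" using below_before_first[OF uX] k K ab by auto
  then obtain x z where "a = x @ (k - 1) # z" by (meson split_list)
  then show False
    using repeat_above_after_below[of x k z b3 "b4 @ [Suc k] @ b2"] uX b b3 ab k by auto
qed

lemma distinct_if_no_neighbours:
  assumes "q @ p \<in> X" "\<And>i. i \<in> set p \<Longrightarrow> Suc i \<notin> set p"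
  shows "distinct p"
proof (rule ccontr)
  assume "\<not> ?thesis"
  then obtain a y b c where p: "p = a @ [y] @ b @ [y] @ c" "y \<notin> set b"
    using not_distinct_first_repeat by blast
  then have "(q @ a) @ [y] @ b @ [y] @ c \<in> X" using assms(1) by simp
  then obtain z where z: "z \<in> set b" "\<not> far y z" using repeat_has_neighbour by blast
  have "z \<noteq> y" using z p by auto
  then have "z = Suc y \<or> y = Suc z" using z unfolding far_def by linarith
  then show False using assms(2)[of y] assms(2)[of z] z p by auto
qed

lemma split_off_low:
  "q @ u \<in> X \<Longrightarrow> 3 \<notin> set u \<Longrightarrow> q @ filter (\<lambda>i. i \<le> 2) u @ filter (\<lambda>i. 2 < i) u \<in> X"
proof (induction u arbitrary: q)
  case (Cons x u)
  have *: "(q @ [x]) @ filter (\<lambda>i. i \<le> 2) u @ filter (\<lambda>i. 2 < i) u \<in> X"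
    using Cons.IH[of "q @ [x]"] Cons.prems by simp
  show ?case
  proof (cases "x \<le> 2")
    case True
    then show ?thesis using * by simp
  next
    case False
    then have "\<forall>y\<in>set (filter (\<lambda>i. i \<le> 2) u). far x y"
      using Cons.prems unfolding far_def by auto
    then show ?thesis
      using move_right[of q x "filter (\<lambda>i. i \<le> 2) u" "filter (\<lambda>i. 2 < i) u"] * False by simp
  qed
qed simp

text \<open>
  After \<open>no_high_edge\<close>, 1 and 2 are the only neighbouring letters that can both occur. In that case
  3 does not occur, so the letters 1 and 2 commute with the rest and can be collected in front, where
  at most two of them avoid all forbidden factors and prefixes.
\<close>

theorem irreducible_fc_form:
  assumes u: "u \<in> X"
  shows "\<exists>q p. q @ p \<in> X \<and> set (q @ p) = set u \<and> distinct p \<and>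
    (\<forall>i\<in>set p. Suc i \<notin> set p) \<and>
    (q = [] \<or> (q = [1, 2] \<or> q = [2, 1]) \<and> (\<forall>i\<in>set p. 4 \<le> i))"
proof (cases "\<exists>i. i \<in> set u \<and> Suc i \<in> set u")
  case False
  then show ?thesis
    using distinct_if_no_neighbours[of "[]" u] u by (intro exI[of _ "[]"] exI[of _ u]) auto
next
  case True
  let ?E = "{i. i \<in> set u \<and> Suc i \<in> set u}"
  have fin: "finite ?E" by (rule finite_subset[of _ "set u"]) auto
  define k where "k = Max ?E"
  have k: "k \<in> set u" "Suc k \<in> set u"
    using Max_in[OF fin] True unfolding k_def by auto
  have kmax: "i \<le> k" if "i \<in> set u" "Suc i \<in> set u" for i
    unfolding k_def using Max_ge[OF fin] that by simp
  have kk: "Suc (Suc k) \<notin> set u" using kmax[of "Suc k"] k by auto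
  then have "k < 2" using no_high_edge[OF u _ k] by fastforce
  then have k1: "k = 1" using pos[OF u k(1)] by simp
  have s: "1 \<in> set u" "2 \<in> set u" "3 \<notin> set u"
    using k kk k1 by (auto simp: numeral_2_eq_2 numeral_3_eq_3)
  define q where "q = filter (\<lambda>i. i \<le> 2) u"
  define p where "p = filter (\<lambda>i. 2 < i) u"
  have qp: "q @ p \<in> X" using split_off_low[of "[]" u] u s unfolding q_def p_def by simp
  have setqp: "set (q @ p) = set u" unfolding q_def p_def by auto
  have p4: "4 \<le> i" if "i \<in> set p" for i
  proof -
    have "i \<noteq> 3" "2 < i" using that s unfolding p_def by auto
    then show ?thesis by linarith
  qed
  have pn: "Suc i \<notin> set p" if "i \<in> set p" for i
    using that kmax[of i] k1 p4[of i] unfolding p_def by auto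
  have "distinct p" using distinct_if_no_neighbours[OF qp] pn by blast
  have q12: "x = 1 \<or> x = 2" if "x \<in> set q" for x
    using that pos[OF u, of x] unfolding q_def by auto
  have q2: "1 \<in> set q" "2 \<in> set q" using s unfolding q_def by auto
  obtain x y q' where q': "q = x # y # q'"
    using q2 by (metis One_nat_def length_0_conv list.set_cases neq_Nil_conv numeral_2_eq_2
        n_not_Suc_n set_ConsD empty_iff list.set(1))
  have xy: "(x = 1 \<and> y = 2) \<or> (x = 2 \<and> y = 1)"
    using q12[of x] q12[of y] q' no_square[of "[]" x "q' @ p"] qp by auto
  have "q' = []"
  proof (cases q')
    case (Cons z q'')
    then have "z = 1 \<or> z = 2" using q12[of z] q' by auto
    moreover have "z \<noteq> y" using no_square[of "[x]" y "q'' @ p"] qp q' Cons by auto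
    ultimately show ?thesis
      using xy no_left4(1)[of "q'' @ p"] no_left4(2)[of "q'' @ p"] qp q' Cons by auto
  qed
  then have "q = [1, 2] \<or> q = [2, 1]" using q' xy by auto
  then show ?thesis
    using qp setqp \<open>distinct p\<close> pn p4 by blast
qed

end

section \<open>Irreducible elements and commuting products\<close>

context parabolic_cartan
begin

lemma normal_formI:
  assumes "normal_form [] p" "s \<in> I" "t \<in> I" "s \<noteq> t" "j < m s t" "\<forall>x\<in>set p. m x s = 2 \<and> m x t = 2"
  shows "normal_form (alt s t j) p"
  using assms unfolding normal_form_def by blast

lemma normal_form_Nil_rev: "normal_form [] p \<Longrightarrow> normal_form [] (rev p)"
  unfolding normal_form_def by (simp add: in_lists_conv_set)

lemma irreducible_commuting:
  assumes f: "normal_form [] p"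
  shows "irreducible (cls p)"
proof -
  have p: "p \<in> lists I" using normal_form_lists[OF f] by simp
  have "\<not> left_weak_star_reducible x y (cls p')" if "normal_form [] p'" "x \<in> I" "y \<in> I" for x y p'
    using normal_form_not_left_reducible[OF that(1) _ _ that(2,3)] by simp
  then show ?thesis
    unfolding irreducible_def using right_reducible_iff_rev[OF p] f normal_form_Nil_rev[OF f] by blast
qed

text \<open>
  Inversion turns \<open>s t p\<close> into \<open>t s p'\<close>, where \<open>p'\<close> is \<open>p\<close> reversed, so right irreducibility is left
  irreducibility of an element of the same kind.
\<close>

lemma irreducible_pair:
  assumes f: "normal_form [] p" and st: "s \<in> I" "t \<in> I" "4 \<le> m s t"
    and c: "\<forall>x\<in>set p. m x s = 2 \<and> m x t = 2"
  shows "irreducible (cls ([s, t] @ p))"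
proof -
  have S: "s \<in> S" "t \<in> S" "m t s = m s t" using st I_subset m_sym by auto
  then have ne: "s \<noteq> t" using m_diag[of s] st by auto
  have left: "\<not> left_weak_star_reducible x y (cls ([s, t] @ p))"
    if f: "normal_form [] p" and st: "s \<in> I" "t \<in> I" "4 \<le> m s t" "4 \<le> m t s" "s \<noteq> t"
      and c: "\<forall>x\<in>set p. m x s = 2 \<and> m x t = 2" and xy: "x \<in> I" "y \<in> I" for x y s t p
  proof -
    have "normal_form (alt s t 2) p" by (rule normal_formI[OF f]) (use st c in auto)
    then have f2: "normal_form [s, t] p" by (simp add: numeral_2_eq_2)
    have "normal_form (alt t s 3) p" by (rule normal_formI[OF f]) (use st c in auto)
    then have f3: "normal_form [t, s, t] p" by (simp add: numeral_3_eq_3)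
    show ?thesis using normal_form_not_left_reducible[OF f2 _ _ xy] f3 by simp
  qed
  have p: "p \<in> lists I" using normal_form_lists[OF f] by simp
  then have w: "[s, t] @ p \<in> lists I" "rev p @ [t, s] \<in> lists I"
    "rev p \<in> lists S" "[t, s] \<in> lists S"
    using st S lists_I_S[OF p] by (auto simp: in_lists_conv_set)
  have "rev p @ [t, s] \<approx> [t, s] @ rev p"
    using commute_words[OF w(3,4)] c by auto
  then have "cls (rev ([s, t] @ p)) = cls ([t, s] @ rev p)"
    using cls_eq[OF w(2)] by simp
  then have "\<not> right_weak_star_reducible x y (cls ([s, t] @ p))" if "x \<in> I" "y \<in> I" for x y
    using right_reducible_iff_rev[OF w(1) that] left[OF normal_form_Nil_rev[OF f], of t s x y] S st ne c that
    by simp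
  moreover have "\<not> left_weak_star_reducible x y (cls ([s, t] @ p))" if "x \<in> I" "y \<in> I" for x y
    using left[OF f, of s t x y] S st ne c that by simp
  ultimately show ?thesis unfolding irreducible_def by blast
qed

lemma irreducible_no_prefix:
  assumes "irreducible (cls u)" "cls u \<in> Wc" "red u" "s \<in> I" "t \<in> I" "3 \<le> m s t"
  shows "u \<noteq> alt s t (m s t - 1) @ v"
  using left_reducible_if_prefix assms unfolding irreducible_def by blast

lemma irreducible_no_suffix:
  assumes "irreducible (cls u)" "cls u \<in> Wc" "red u" "s \<in> I" "t \<in> I" "3 \<le> m s t"
  shows "rev u \<noteq> alt s t (m s t - 1) @ v"
proof
  assume *: "rev u = alt s t (m s t - 1) @ v"
  have "left_weak_star_reducible s t (cls (rev u))"
    using left_reducible_if_prefix[OF red_rev[OF assms(3)] * assms(4-6)] cls_rev_in_Wc[OF assms(3,2)]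
    by simp
  then have "right_weak_star_reducible s t (cls u)"
    using right_reducible_iff_rev[OF red_lists[OF assms(3)] assms(4,5)] by simp
  then show False using assms unfolding irreducible_def by blast
qed

lemma red_no_square: "\<not> red (a @ [s, s] @ b)"
proof
  assume "red (a @ [s, s] @ b)"
  then have r: "red [s, s]" by (rule red_append)
  then have "[s, s] \<approx> []" using square_cancel[of s] red_lists[OF r] I_subset by auto
  then show False using r unfolding red_def by (metis lists.Nil list.size(3) length_Cons le_zero_eq nat.distinct(1))
qed

text \<open>
  Commuting products are defined by commutation in the group; this turns the condition into one on
  exponents.
\<close>

lemma gens_commute_iff:
  assumes "s \<in> I" "t \<in> I" "s \<noteq> t"
  shows "gen s \<otimes>\<^bsub>W\<^esub> gen t = gen t \<otimes>\<^bsub>W\<^esub> gen s \<longleftrightarrow> m s t = 2"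
proof -
  have S: "s \<in> S" "t \<in> S" using assms I_subset by auto
  have "gen s \<otimes>\<^bsub>W\<^esub> gen t = gen t \<otimes>\<^bsub>W\<^esub> gen s \<longleftrightarrow> [s, t] \<approx> [t, s]"
    using gen_mult_cls[of s "[t]"] gen_mult_cls[of t "[s]"] cls_eq[of "[s, t]"] assms
    by (simp add: gen_def)
  also have "\<dots> \<longleftrightarrow> m s t = 2"
  proof
    assume "[s, t] \<approx> [t, s]"
    then have "\<not> 2 < m s t" using alt_neq[OF S assms(3), of 2] by (auto simp: numeral_2_eq_2)
    then show "m s t = 2" using m_off_diag[OF S assms(3)] by linarith
  qed (rule commute_two[OF S])
  finally show ?thesis .
qed

lemma commuting_products_eq: "commuting_products = {cls p | p. normal_form [] p}"
proof (intro equalityI subsetI)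
  fix w assume "w \<in> commuting_products"
  then obtain u where u: "u \<in> lists I" "distinct u" "w = word_prod u"
    "\<forall>s\<in>set u. \<forall>t\<in>set u. gen s \<otimes>\<^bsub>W\<^esub> gen t = gen t \<otimes>\<^bsub>W\<^esub> gen s"
    unfolding commuting_products_def by blast
  have "m x y = 2" if "x \<in> set u" "y \<in> set u" "x \<noteq> y" for x y
    using gens_commute_iff[of x y] u that by auto
  then have "normal_form [] u" using u unfolding normal_form_def by blast
  then show "w \<in> {cls p | p. normal_form [] p}" using u word_prod_cls by blast
next
  fix w assume "w \<in> {cls p | p. normal_form [] p}"
  then obtain p where p: "normal_form [] p" "w = cls p" by blast
  have pI: "p \<in> lists I" using normal_form_lists p by blast
  have "gen s \<otimes>\<^bsub>W\<^esub> gen t = gen t \<otimes>\<^bsub>W\<^esub> gen s" if "s \<in> set p" "t \<in> set p" for s t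
    using gens_commute_iff[of s t] p(1) that unfolding normal_form_def by (cases "s = t") auto
  then show "w \<in> commuting_products"
    using normal_form_in_Wc[OF p(1)] p pI word_prod_cls[OF pI] unfolding commuting_products_def normal_form_def
    by auto
qed

lemma supp_commuting:
  assumes "normal_form [] p"
  shows "supp (cls p) = set p"
proof -
  have p: "p \<in> lists I" "red p" using normal_form_lists[OF assms] normal_form_red[OF assms] by auto
  have "p \<approx> p" using p lists_I_S cox_eq.refl by blast
  moreover have "set v = set p" if "red v" "p \<approx> v" for v
    using normal_form_unique[OF assms that(1)] that(2) commutations_set by simp
  ultimately show ?thesis
    unfolding supp_def using reduced_expr_iff[OF p(1)] p(2) by blast
qed

end

section \<open>Irreducible elements in type B\<close>

text \<open>
  The labelling \<open>c\<close> runs along the Coxeter graph of type \<open>B\<close>, starting at the double edge.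
\<close>

locale type_B = parabolic_cartan S m I A
  for S :: "'a set" and m and I and A +
  fixes n :: nat and c :: "nat \<Rightarrow> 'a"
  assumes two_le_n: "2 \<le> n"
    and I_eq: "I = c ` {1..n}"
    and inj_c: "inj_on c {1..n}"
    and m_far: "i \<in> {1..n} \<Longrightarrow> j \<in> {1..n} \<Longrightarrow> far i j \<Longrightarrow> m (c i) (c j) = 2"
    and m_simple_edge: "i \<in> {1..n} \<Longrightarrow> j \<in> {1..n} \<Longrightarrow> simple_edge i j \<Longrightarrow> m (c i) (c j) = 3"
    and m_double_edge: "m (c 1) (c 2) = 4"
begin

lemma c_I: "i \<in> {1..n} \<Longrightarrow> c i \<in> I"
  by (simp add: I_eq)

lemma c12: "c 1 \<in> I" "c 2 \<in> I" "m (c 2) (c 1) = 4"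
  using c_I[of 1] c_I[of 2] two_le_n m_double_edge m_sym[of "c 1" "c 2"] I_subset by auto

definition words :: "'a list set \<Rightarrow> nat list set" where
  "words w = {u \<in> lists {1..n}. red (map c u) \<and> cls (map c u) = w}"

lemma words_no_braid:
  assumes "w \<in> Wc" "s \<in> I" "t \<in> I" "3 \<le> m s t" "map c v = a @ alt s t (m s t) @ b"
  shows "v \<notin> words w"
  using braid_not_in_Wc[of a s t b] assms unfolding words_def by auto

lemma words_no_prefix:
  assumes "w \<in> Wc" "irreducible w" "s \<in> I" "t \<in> I" "3 \<le> m s t"
    and "map c v = alt s t (m s t - 1) @ b"
  shows "v \<notin> words w"
  using irreducible_no_prefix[of "map c v" s t b] assms unfolding words_def by auto

lemma words_no_suffix:
  assumes "w \<in> Wc" "irreducible w" "s \<in> I" "t \<in> I" "3 \<le> m s t"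
    and "rev (map c v) = alt s t (m s t - 1) @ b"
  shows "v \<notin> words w"
  using irreducible_no_suffix[of "map c v" s t b] assms unfolding words_def by auto

lemma irreducible_fc_words:
  assumes fc: "w \<in> Wc" and irr: "irreducible w"
  shows "irreducible_fc (words w)"
proof
  fix u i assume "u \<in> words w" "i \<in> set u"
  then show "1 \<le> i" unfolding words_def by auto
next
  fix a i j b assume u: "a @ [i, j] @ b \<in> words w" and far: "far i j"
  let ?u = "map c a @ [c i, c j] @ map c b" and ?v = "map c a @ [c j, c i] @ map c b"
  have r: "red ?u" "cls ?u = w" "i \<in> {1..n}" "j \<in> {1..n}" "a \<in> lists {1..n}" "b \<in> lists {1..n}"
    using u unfolding words_def by auto
  have uI: "?u \<in> lists I" and vI: "?v \<in> lists I" using red_lists[OF r(1)] by auto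
  have S: "map c a \<in> lists S" "map c b \<in> lists S" "c i \<in> S" "c j \<in> S"
    using lists_I_S[OF uI] by auto
  have e: "?u \<approx> ?v"
    using cox_eq_context[OF commute_two[OF S(3,4) m_far[OF r(3,4) far]] S(1,2)] .
  have "red ?v" using red_transfer[OF r(1) e vI] by simp
  moreover have "cls ?v = w" using cls_eq[OF uI, of ?v] e r(2) by simp
  ultimately show "a @ [j, i] @ b \<in> words w" using r unfolding words_def by simp
next
  fix a i b show "a @ [i, i] @ b \<notin> words w"
    using red_no_square[of "map c a" "c i" "map c b"] unfolding words_def by auto
next
  fix i j a b assume e: "simple_edge i j"
  show "a @ [i, j, i] @ b \<notin> words w"
  proof
    assume u: "a @ [i, j, i] @ b \<in> words w"
    then have ij: "i \<in> {1..n}" "j \<in> {1..n}" unfolding words_def by auto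
    have m3: "m (c i) (c j) = 3" using m_simple_edge[OF ij e] .
    have "a @ [i, j, i] @ b \<notin> words w"
      by (rule words_no_braid[OF fc c_I[OF ij(1)] c_I[OF ij(2)], of _ "map c a" "map c b"],
          unfold m3, simp, simp add: eval_nat_numeral)
    then show False using u by contradiction
  qed
next
  fix a b
  show "a @ [1, 2, 1, 2] @ b \<notin> words w"
    by (rule words_no_braid[OF fc c12(1,2), of _ "map c a" "map c b"],
        unfold m_double_edge, simp, simp add: eval_nat_numeral)
next
  fix a b
  show "a @ [2, 1, 2, 1] @ b \<notin> words w"
    by (rule words_no_braid[OF fc c12(2,1), of _ "map c a" "map c b"],
        unfold c12(3), simp, simp add: eval_nat_numeral)
next
  fix i j b assume e: "simple_edge i j"
  show "[i, j] @ b \<notin> words w"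
  proof
    assume u: "[i, j] @ b \<in> words w"
    then have ij: "i \<in> {1..n}" "j \<in> {1..n}" unfolding words_def by auto
    have m3: "m (c i) (c j) = 3" using m_simple_edge[OF ij e] .
    have "[i, j] @ b \<notin> words w"
      by (rule words_no_prefix[OF fc irr c_I[OF ij(1)] c_I[OF ij(2)], of _ "map c b"],
          unfold m3, simp, simp add: eval_nat_numeral)
    then show False using u by contradiction
  qed
next
  fix b
  show "[1, 2, 1] @ b \<notin> words w"
    by (rule words_no_prefix[OF fc irr c12(1,2), of _ "map c b"],
        unfold m_double_edge, simp, simp add: eval_nat_numeral)
next
  fix b
  show "[2, 1, 2] @ b \<notin> words w"
    by (rule words_no_prefix[OF fc irr c12(2,1), of _ "map c b"],
        unfold c12(3), simp, simp add: eval_nat_numeral)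
next
  fix i j a assume e: "simple_edge i j"
  show "a @ [i, j] \<notin> words w"
  proof
    assume u: "a @ [i, j] \<in> words w"
    then have ij: "i \<in> {1..n}" "j \<in> {1..n}" unfolding words_def by auto
    have m3: "m (c j) (c i) = 3" using m_simple_edge[OF ij(2,1) e[unfolded simple_edge_commute[of i j]]] .
    have "a @ [i, j] \<notin> words w"
      by (rule words_no_suffix[OF fc irr c_I[OF ij(2)] c_I[OF ij(1)], of _ "rev (map c a)"],
          unfold m3, simp, simp add: eval_nat_numeral)
    then show False using u by contradiction
  qed
next
  fix a
  show "a @ [1, 2, 1] \<notin> words w"
    by (rule words_no_suffix[OF fc irr c12(1,2), of _ "rev (map c a)"],
        unfold m_double_edge, simp, simp add: eval_nat_numeral)
next
  fix a
  show "a @ [2, 1, 2] \<notin> words w"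
    by (rule words_no_suffix[OF fc irr c12(2,1), of _ "rev (map c a)"],
        unfold c12(3), simp, simp add: eval_nat_numeral)
qed

lemma gen_gen_cls:
  assumes "s \<in> I" "t \<in> I" "p \<in> lists I"
  shows "gen s \<otimes>\<^bsub>W\<^esub> gen t \<otimes>\<^bsub>W\<^esub> cls p = cls ([s, t] @ p)"
proof -
  have "gen s \<otimes>\<^bsub>W\<^esub> gen t = cls [s, t]"
    using gen_mult_cls[of s "[t]"] assms by (simp add: gen_def)
  then show ?thesis
    using mult_cls[of "[s, t]" p] assms lists_I_S[OF assms(3)] I_subset by auto
qed

text \<open>
  An irreducible element has a reduced word of the shape found in \<open>irreducible_fc_form\<close>, whose
  commuting part has letters at least 4 when 1 and 2 occur. Conversely, avoiding 1, 2 and 3 makes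
  the commuting part commute with the first two generators, as \<open>irreducible_pair\<close> demands.
\<close>

theorem irreducible_iff:
  assumes fc: "w \<in> Wc"
  shows "irreducible w \<longleftrightarrow> (\<exists>w\<^sub>p \<in> commuting_products. w = w\<^sub>p \<or>
      w = gen (c 1) \<otimes>\<^bsub>W\<^esub> gen (c 2) \<otimes>\<^bsub>W\<^esub> w\<^sub>p \<and> c 1 \<notin> supp w\<^sub>p \<and> c 2 \<notin> supp w\<^sub>p \<and> c 3 \<notin> supp w\<^sub>p \<or>
      w = gen (c 2) \<otimes>\<^bsub>W\<^esub> gen (c 1) \<otimes>\<^bsub>W\<^esub> w\<^sub>p \<and> c 1 \<notin> supp w\<^sub>p \<and> c 2 \<notin> supp w\<^sub>p \<and> c 3 \<notin> supp w\<^sub>p)"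
    (is "_ \<longleftrightarrow> ?R")
proof
  assume irr: "irreducible w"
  have X: "irreducible_fc (words w)" using irreducible_fc_words fc irr .
  obtain u0 where u0: "u0 \<in> lists I" "w = cls u0" using fc unfolding Wc_def P_eq by auto
  obtain u1 where u1: "red u1" "u0 \<approx> u1" using ex_red[OF u0(1)] by blast
  have "set u1 \<subseteq> c ` {1..n}" using red_lists[OF u1(1)] I_eq by auto
  then obtain u where u: "u \<in> lists {1..n}" "u1 = map c u"
    by (metis (no_types, lifting) lists_image in_lists_conv_set subsetD imageE)
  have "cls u1 = w" using cls_eq[OF u0(1), of u1] u0(2) u1(2) by blast
  then have "u \<in> words w" using u u1(1) unfolding words_def by simp
  from irreducible_fc.irreducible_fc_form[OF X this]
  obtain q p where qp: "q @ p \<in> words w" "distinct p" "\<forall>i\<in>set p. Suc i \<notin> set p"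
    "q = [] \<or> (q = [1, 2] \<or> q = [2, 1]) \<and> (\<forall>i\<in>set p. 4 \<le> i)"
    by blast
  have w: "w = cls (map c q @ map c p)" and pn: "set p \<subseteq> {1..n}"
    using qp(1) unfolding words_def by auto
  have inj_p: "inj_on c (set p)" using inj_c pn by (rule inj_on_subset)
  have "m (c i) (c j) = 2" if "i \<in> set p" "j \<in> set p" "c i \<noteq> c j" for i j
  proof -
    have "i \<noteq> j" "j \<noteq> Suc i" "i \<noteq> Suc j" using that qp(3) by auto
    then have "far i j" unfolding far_def by linarith
    then show ?thesis using m_far pn that by blast
  qed
  then have f: "normal_form [] (map c p)"
    using subsetD[OF pn, THEN c_I] qp(2) inj_p unfolding normal_form_def by (auto simp: distinct_map)
  let ?wp = "cls (map c p)"
  have wp: "?wp \<in> commuting_products" using f unfolding commuting_products_eq by blast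
  have pI: "map c p \<in> lists I" using normal_form_lists[OF f] by simp
  show ?R
  proof (cases "q = []")
    case True
    then show ?thesis using wp w by auto
  next
    case False
    then have p4: "\<forall>i\<in>set p. 4 \<le> i" using qp(4) by blast
    have "c k \<notin> supp ?wp" if "1 \<le> k" "k \<le> 3" for k
    proof
      assume "c k \<in> supp ?wp"
      then obtain i where i: "i \<in> set p" "c k = c i" unfolding supp_commuting[OF f] by auto
      have "i \<in> {1..n}" "4 \<le> i" using i pn p4 by auto
      then have "k \<in> {1..n}" "k \<noteq> i" using that by auto
      then show False using inj_c i(2) \<open>i \<in> {1..n}\<close> by (auto dest: inj_onD)
    qed
    then have "c 1 \<notin> supp ?wp" "c 2 \<notin> supp ?wp" "c 3 \<notin> supp ?wp" by simp_all
    moreover have "w = gen (c 1) \<otimes>\<^bsub>W\<^esub> gen (c 2) \<otimes>\<^bsub>W\<^esub> ?wp \<or> w = gen (c 2) \<otimes>\<^bsub>W\<^esub> gen (c 1) \<otimes>\<^bsub>W\<^esub> ?wp"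
      using False qp(4) w gen_gen_cls[OF c12(1,2) pI] gen_gen_cls[OF c12(2,1) pI] by auto
    ultimately show ?thesis using wp by blast
  qed
next
  assume ?R
  then obtain p where f: "normal_form [] p" and
    cases: "w = cls p \<or>
      (w = gen (c 1) \<otimes>\<^bsub>W\<^esub> gen (c 2) \<otimes>\<^bsub>W\<^esub> cls p \<or> w = gen (c 2) \<otimes>\<^bsub>W\<^esub> gen (c 1) \<otimes>\<^bsub>W\<^esub> cls p) \<and>
      c 1 \<notin> supp (cls p) \<and> c 2 \<notin> supp (cls p) \<and> c 3 \<notin> supp (cls p)"
    unfolding commuting_products_eq by blast
  have pI: "p \<in> lists I" using normal_form_lists[OF f] by simp
  show "irreducible w"
  proof (cases "w = cls p")
    case True
    then show ?thesis using irreducible_commuting[OF f] by simp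
  next
    case False
    then have s: "c 1 \<notin> set p" "c 2 \<notin> set p" "c 3 \<notin> set p"
      using cases unfolding supp_commuting[OF f] by auto
    have "m x (c 1) = 2 \<and> m x (c 2) = 2" if x: "x \<in> set p" for x
    proof -
      obtain i where i: "i \<in> {1..n}" "x = c i" using pI x I_eq by auto
      have "i \<noteq> 1" "i \<noteq> 2" "i \<noteq> 3" using i s x by auto
      then have "far i 1" "far i 2" using i unfolding far_def by auto
      then show ?thesis using m_far i two_le_n by auto
    qed
    then have comm: "\<forall>x\<in>set p. m x (c 1) = 2 \<and> m x (c 2) = 2" "\<forall>x\<in>set p. m x (c 2) = 2 \<and> m x (c 1) = 2"
      by auto
    then show ?thesis
      using False cases irreducible_pair[OF f c12(1,2) _ comm(1)] irreducible_pair[OF f c12(2,1) _ comm(2)]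
        gen_gen_cls[OF c12(1,2) pI] gen_gen_cls[OF c12(2,1) pI] m_double_edge c12(3) by auto
  qed
qed

end

section \<open>The two parabolic subgroups of type B in affine type C\<close>

text \<open>
  At a double edge the entries must be \<open>-1\<close> and \<open>-2\<close> in some order, which \<open>i < j\<close> decides.
\<close>

definition cartan_C :: "nat \<Rightarrow> nat \<Rightarrow> nat \<Rightarrow> int" where
  "cartan_C n i j =
    (if i = j then 2 else if far i j then 0 else if m_C n i j = 4 \<and> i < j then -2 else -1)"

lemma m_C_far: "far i j \<Longrightarrow> m_C n i j = 2"
  unfolding m_C_def far_def by auto

lemma m_C_sym: "m_C n i j = m_C n j i"
  unfolding m_C_def by (simp add: insert_commute abs_minus_commute)

lemma m_C_adjacent:
  "m_C n i (Suc i) = (if i = 1 \<or> i = n then 4 else 3)"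
  unfolding m_C_def by (auto simp: doubleton_eq_iff)

lemma cartan_C: "cartan (gens_C n) (m_C n) (cartan_C n)"
proof (intro cartan.intro coxeter_C cartan_axioms.intro)
  fix s t :: nat assume "s \<noteq> t"
  then consider "far s t" | "t = Suc s" | "s = Suc t" unfolding far_def by linarith
  then show "m_C n s t = 2 \<and> cartan_C n s t = 0 \<and> cartan_C n t s = 0 \<or>
      m_C n s t = 3 \<and> cartan_C n s t = -1 \<and> cartan_C n t s = -1 \<or>
      m_C n s t = 4 \<and> (cartan_C n s t = -1 \<and> cartan_C n t s = -2 \<or>
        cartan_C n s t = -2 \<and> cartan_C n t s = -1)"
  proof cases
    case 1
    then show ?thesis using m_C_far[OF 1] \<open>s \<noteq> t\<close> far_sym[of s t] by (simp add: cartan_C_def)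
  next
    case 2
    then show ?thesis using m_C_sym[of n t s] by (auto simp: cartan_C_def far_def m_C_adjacent)
  next
    case 3
    then show ?thesis using m_C_sym[of n s t] by (auto simp: cartan_C_def far_def m_C_adjacent)
  qed
qed (simp add: cartan_C_def)

lemma m_C_simple_edge:
  assumes "simple_edge i j" "i \<le> n" "j \<le> n"
  shows "m_C n i j = 3"
proof -
  consider "j = Suc i" | "i = Suc j" using assms unfolding simple_edge_def by blast
  then show ?thesis
    by cases (use assms m_C_sym[of n i j] in \<open>auto simp: m_C_adjacent simple_edge_def\<close>)
qed

lemma type_B_B:
  assumes "2 \<le> n"
  shows "type_B (gens_C n) (m_C n) (gens_B n) (cartan_C n) n (\<lambda>i. i)"
proof (intro type_B.intro parabolic_cartan.intro parabolic_B cartan_C type_B_axioms.intro assms)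
  show "m_C n 1 2 = 4" using m_C_adjacent[of n 1] by (simp add: numeral_2_eq_2)
qed (auto simp: m_C_far m_C_simple_edge)

lemma type_B_B':
  assumes n: "2 \<le> n"
  shows "type_B (gens_C n) (m_C n) (gens_B' n) (cartan_C n) n (\<lambda>i. n + 2 - i)"
proof (intro type_B.intro parabolic_cartan.intro parabolic_B' cartan_C type_B_axioms.intro assms)
  show "gens_B' n = (\<lambda>i. n + 2 - i) ` {1..n}"
  proof (intro equalityI subsetI)
    fix x assume "x \<in> gens_B' n"
    then show "x \<in> (\<lambda>i. n + 2 - i) ` {1..n}"
      by (intro image_eqI[of _ _ "n + 2 - x"]) auto
  qed auto
  show "inj_on (\<lambda>i. n + 2 - i) {1..n}" by (auto simp: inj_on_def)
  show "m_C n (n + 2 - 1) (n + 2 - 2) = 4"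
    using m_C_adjacent[of n n] m_C_sym[of n "Suc n" n] by simp
next
  fix i j assume ij: "i \<in> {1..n}" "j \<in> {1..n}"
  show "m_C n (n + 2 - i) (n + 2 - j) = 2" if "far i j"
    using that ij by (intro m_C_far) (auto simp: far_def)
  show "m_C n (n + 2 - i) (n + 2 - j) = 3" if "simple_edge i j"
    using that ij by (intro m_C_simple_edge) (auto simp: simple_edge_def)
qed

theorem theorem4p1p1:
  fixes n :: nat
  assumes "2 \<le> n"
  shows
    "(\<forall>w \<in> Wc_B n.
        irreducible_B n w \<longleftrightarrow>
        (\<exists>w\<^sub>p \<in> commuting_products_B n.
           w = w\<^sub>p \<or>
           w = s_C n 1 \<otimes>\<^bsub>W_C n\<^esub> s_C n 2 \<otimes>\<^bsub>W_C n\<^esub> w\<^sub>p \<and>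
             1 \<notin> supp_B n w\<^sub>p \<and> 2 \<notin> supp_B n w\<^sub>p \<and> 3 \<notin> supp_B n w\<^sub>p \<or>
           w = s_C n 2 \<otimes>\<^bsub>W_C n\<^esub> s_C n 1 \<otimes>\<^bsub>W_C n\<^esub> w\<^sub>p \<and>
             1 \<notin> supp_B n w\<^sub>p \<and> 2 \<notin> supp_B n w\<^sub>p \<and> 3 \<notin> supp_B n w\<^sub>p)) \<and>
     (\<forall>w \<in> Wc_B' n.
        irreducible_B' n w \<longleftrightarrow>
        (\<exists>w\<^sub>p \<in> commuting_products_B' n.
           w = w\<^sub>p \<or>
           w = s_C n (n + 1) \<otimes>\<^bsub>W_C n\<^esub> s_C n n \<otimes>\<^bsub>W_C n\<^esub> w\<^sub>p \<and>
             n + 1 \<notin> supp_B' n w\<^sub>p \<and> n \<notin> supp_B' n w\<^sub>p \<and> n - 1 \<notin> supp_B' n w\<^sub>p \<or>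
           w = s_C n n \<otimes>\<^bsub>W_C n\<^esub> s_C n (n + 1) \<otimes>\<^bsub>W_C n\<^esub> w\<^sub>p \<and>
             n + 1 \<notin> supp_B' n w\<^sub>p \<and> n \<notin> supp_B' n w\<^sub>p \<and> n - 1 \<notin> supp_B' n w\<^sub>p))"
proof -
  have c: "n + 2 - 1 = n + 1" "n + 2 - 2 = n" "n + 2 - 3 = n - 1" by simp_all
  show ?thesis
    using type_B.irreducible_iff[OF type_B_B[OF assms]]
      type_B.irreducible_iff[OF type_B_B'[OF assms], unfolded c]
    by blast
qed

end
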